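(* Let $m_1,\ldots,m_h$ be positive integers, let $G\in\mathcal{BG}(m_1+1,m_2+1,\ldots,m_h+1)$, let $1\leq k\leq m_1$, let $\underline{r}$ be a refinement of the multiset $\{k,m_1+1-k,m_2,\ldots,m_h\}$, and let $\sigma$ be a multiset of real numbers whose multiplicity list is $\underline{r}$. Then there is a matrix $A\in\mathcal{S}(G)$ with the strong spectral property and $\operatorname{spec}(A)=\sigma$.
   Context: A graph on at least 2 vertices is 2-connected if it is connected and remains connected after deleting any single vertex. A block of a graph is a maximal 2-connected induced subgraph. A block graph is a connected graph all of whose blocks are complete graphs; $\mathcal{BG}(b_1,\ldots,b_h)$ is the family of block graphs with exactly $h$ blocks, of sizes $b_1,\ldots,b_h$ (such a graph has $1+\sum_i(b_i-1)$ vertices). For a graph $G$ on $n$ vertices, $\mathcal{S}(G)$ is the set of $n\times n$ real symmetric matrices $(a_{ij})$ with, for $i\neq j$, $a_{ij}\neq0$ iff $\{i,j\}\in E(G)$. A real symmetric $A$ has the strong spectral property if the only real symmetric $X$ with $A\circ X=O$, $I\circ X=O$, $AX-XA=O$ is $X=O$. A refinement of a multiset of positive integers $\{a_1,\ldots,a_t\}$ is a multiset $\{b_{1,1},\ldots,b_{1,r_1},\ldots,b_{t,1},\ldots,b_{t,r_t}\}$ of positive integers with $\sum_{j}b_{i,j}=a_i$ for each $i$. The multiplicity list of a multiset of reals is the (unordered) multiset of multiplicities of its distinct elements. *)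

theory Defs
  imports "Jordan_Normal_Form.Char_Poly" "HOL-Library.Multiset"
begin

text \<open>Simple graphs on the vertex set {0..<n}; an edge is a 2-element set {i,j}.\<close>

definition simple_graph :: "nat \<Rightarrow> nat set set \<Rightarrow> bool" where
  "simple_graph n E \<longleftrightarrow> (\<forall>e\<in>E. \<exists>i j. e = {i, j} \<and> i \<noteq> j \<and> i < n \<and> j < n)"

text \<open>Adjacency relation of the subgraph induced on the vertex set V.\<close>
definition adj_on :: "nat set set \<Rightarrow> nat set \<Rightarrow> (nat \<times> nat) set" where
  "adj_on E V = {(u, v). u \<in> V \<and> v \<in> V \<and> {u, v} \<in> E}"

text \<open>The induced subgraph on V is connected (V nonempty).\<close>
definition connected_on :: "nat set set \<Rightarrow> nat set \<Rightarrow> bool" where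
  "connected_on E V \<longleftrightarrow> V \<noteq> {} \<and> (\<forall>u\<in>V. \<forall>v\<in>V. (u, v) \<in> (adj_on E V)\<^sup>*)"

text \<open>The induced subgraph on V is 2-connected: at least 2 vertices, connected, and
  connected after deleting any single vertex.\<close>
definition two_connected_on :: "nat set set \<Rightarrow> nat set \<Rightarrow> bool" where
  "two_connected_on E V \<longleftrightarrow> finite V \<and> card V \<ge> 2 \<and> connected_on E V \<and>
     (\<forall>x\<in>V. connected_on E (V - {x}))"

text \<open>A block: vertex set of a maximal 2-connected induced subgraph of G = ({0..<n}, E).\<close>
definition is_block :: "nat \<Rightarrow> nat set set \<Rightarrow> nat set \<Rightarrow> bool" where
  "is_block n E B \<longleftrightarrow> B \<subseteq> {0..<n} \<and> two_connected_on E B \<and>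
     (\<forall>W. B \<subset> W \<and> W \<subseteq> {0..<n} \<longrightarrow> \<not> two_connected_on E W)"

definition blocks :: "nat \<Rightarrow> nat set set \<Rightarrow> nat set set" where
  "blocks n E = {B. is_block n E B}"

definition block_graph :: "nat \<Rightarrow> nat set set \<Rightarrow> bool" where
  "block_graph n E \<longleftrightarrow> simple_graph n E \<and> connected_on E {0..<n} \<and>
     (\<forall>B\<in>blocks n E. \<forall>u\<in>B. \<forall>v\<in>B. u \<noteq> v \<longrightarrow> {u, v} \<in> E)"

text \<open>G \<in> BG(b_1,...,b_h): block graph whose blocks have sizes (as a multiset) b_1,...,b_h.\<close>
definition in_BG :: "nat \<Rightarrow> nat set set \<Rightarrow> nat list \<Rightarrow> bool" where
  "in_BG n E bs \<longleftrightarrow> block_graph n E \<and>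
     image_mset card (mset_set (blocks n E)) = mset bs"

text \<open>The class S(G) of real symmetric n x n matrices with graph G.\<close>
definition in_S :: "nat \<Rightarrow> nat set set \<Rightarrow> real mat \<Rightarrow> bool" where
  "in_S n E A \<longleftrightarrow> A \<in> carrier_mat n n \<and> A\<^sup>T = A \<and>
     (\<forall>i<n. \<forall>j<n. i \<noteq> j \<longrightarrow> (A $$ (i, j) \<noteq> 0 \<longleftrightarrow> {i, j} \<in> E))"

text \<open>Strong spectral property.\<close>
definition SSP :: "real mat \<Rightarrow> bool" where
  "SSP A \<longleftrightarrow> (\<forall>X \<in> carrier_mat (dim_row A) (dim_row A).
     X\<^sup>T = X \<and>
     (\<forall>i<dim_row A. \<forall>j<dim_row A. A $$ (i, j) * X $$ (i, j) = 0) \<and>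
     (\<forall>i<dim_row A. X $$ (i, i) = 0) \<and>
     A * X - X * A = 0\<^sub>m (dim_row A) (dim_row A)
     \<longrightarrow> X = 0\<^sub>m (dim_row A) (dim_row A))"

text \<open>spec(A) = \<sigma>: the multiset of eigenvalues (with algebraic multiplicity) is \<sigma>.\<close>
definition spec_is :: "real mat \<Rightarrow> real multiset \<Rightarrow> bool" where
  "spec_is A \<sigma> \<longleftrightarrow> char_poly A = prod_mset (image_mset (\<lambda>x. [:- x, 1:]) \<sigma>)"

text \<open>r is a refinement of the multiset a of positive integers.\<close>
definition refinement_of :: "nat multiset \<Rightarrow> nat multiset \<Rightarrow> bool" where
  "refinement_of r a \<longleftrightarrow> (\<forall>x\<in>#r. x > 0) \<and>
     (\<exists>P :: nat multiset multiset. image_mset sum_mset P = a \<and> sum_mset P = r)"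

definition mult_list :: "'a multiset \<Rightarrow> nat multiset" where
  "mult_list \<sigma> = image_mset (count \<sigma>) (mset_set (set_mset \<sigma>))"

end

(*
  Label the vertices by the prescribed eigenvalues, following the block tree from a root block of
  size m_1 + 1: the root block receives the two groups of sizes k and m_1 + 1 - k, every other block
  receives its own group on its vertices other than the one by which it hangs on the part already
  labelled. Distinct groups have no eigenvalue in common, so vertices with equal labels are adjacent
  and have a common neighbour with another label.
  Such a labelling d suffices. Let D = diag(d) and let W be a symmetric matrix supported on the
  edges between different labels. For small t > 0 a contraction yields a matrix C, block diagonal
  with respect to the level sets of d, such that C + tW is similar to D. It tends to D as t tends
  to 0, and since equal labels occur only on adjacent vertices, commuting with a matrix close to D
  forces the matrix X in the strong spectral property to vanish. The entries of C between distinct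
  vertices with equal labels are nonzero multiples of t^2 up to O(t^3) for generic W, because of the
  common neighbours.
*)
theory Submission
  imports Defs
begin

section \<open>Blocks and the block tree\<close>

lemma adj_on_mono: "V \<subseteq> W \<Longrightarrow> (adj_on E V)\<^sup>* \<subseteq> (adj_on E W)\<^sup>*"
  by (rule rtrancl_mono) (auto simp: adj_on_def)

lemma adj_on_rtrancl_sym:
  assumes "(u, v) \<in> (adj_on E V)\<^sup>*"
  shows "(v, u) \<in> (adj_on E V)\<^sup>*"
proof -
  have "sym (adj_on E V)"
    by (auto simp: adj_on_def sym_def insert_commute)
  then show ?thesis
    using assms by (meson sym_rtrancl symD)
qed

lemma connected_onI:
  assumes "c \<in> V" and "\<And>v. v \<in> V \<Longrightarrow> (v, c) \<in> (adj_on E V)\<^sup>*"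
  shows "connected_on E V"
  unfolding connected_on_def
proof (intro conjI ballI)
  fix u v assume "u \<in> V" "v \<in> V"
  then show "(u, v) \<in> (adj_on E V)\<^sup>*"
    using assms(2)[of u] adj_on_rtrancl_sym[OF assms(2)[of v]] by (meson rtrancl_trans)
qed (use assms in blast)

lemma connected_on_Un:
  assumes "connected_on E V" "connected_on E W" "c \<in> V" "c \<in> W"
  shows "connected_on E (V \<union> W)"
proof (rule connected_onI)
  show "c \<in> V \<union> W" using assms by simp
next
  fix v assume "v \<in> V \<union> W"
  then have "(v, c) \<in> (adj_on E V)\<^sup>* \<or> (v, c) \<in> (adj_on E W)\<^sup>*"
    using assms unfolding connected_on_def by blast
  then show "(v, c) \<in> (adj_on E (V \<union> W))\<^sup>*"
    using adj_on_mono[of V "V \<union> W" E] adj_on_mono[of W "V \<union> W" E] by blast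
qed

text \<open>If no edge of the induced subgraph left \<open>U\<close>, a path starting in
  \<open>U\<close> could never get out of it. This supplies the edge along which the traversal of
  the blocks grows.\<close>

lemma connected_on_edge_cut:
  assumes "connected_on E V" "u \<in> U" "u \<in> V" "v \<in> V" "v \<notin> U"
  shows "\<exists>a b. a \<in> U \<inter> V \<and> b \<in> V - U \<and> {a, b} \<in> E"
proof (rule ccontr)
  assume neg: "\<not> ?thesis"
  have "(u, v) \<in> (adj_on E V)\<^sup>*"
    using assms unfolding connected_on_def by blast
  then have "v \<in> U"
  proof induction
    case base
    show ?case by (fact assms(2))
  next
    case (step y z)
    then show ?case using neg unfolding adj_on_def by blast
  qed
  with assms show False by blast
qed

lemma connected_on_ex_edge:
  assumes "connected_on E V" "u \<in> V" "v \<in> V" "u \<noteq> v"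
  shows "\<exists>b. b \<in> V \<and> b \<noteq> u \<and> {u, b} \<in> E"
  using connected_on_edge_cut[OF assms(1), of u "{u}" v] assms(2-4) by auto

section \<open>2-connected sets and blocks\<close>

lemma two_connected_on_connected_Diff:
  "two_connected_on E V \<Longrightarrow> connected_on E (V - {x})"
  unfolding two_connected_on_def by (cases "x \<in> V") auto

text \<open>Deleting a single vertex spares at least one of \<open>a\<close> and \<open>b\<close>,
  and the two connected remainders are glued there.\<close>

lemma two_connected_on_Un:
  assumes V: "two_connected_on E V" and W: "two_connected_on E W"
    and ab: "a \<in> V \<inter> W" "b \<in> V \<inter> W" "a \<noteq> b"
  shows "two_connected_on E (V \<union> W)"
proof -
  have fin: "finite V" "finite W" and "card V \<ge> 2"
    using V W unfolding two_connected_on_def by auto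
  moreover have "card V \<le> card (V \<union> W)"
    using fin by (intro card_mono) auto
  moreover have "connected_on E (V \<union> W)"
    using V W ab connected_on_Un unfolding two_connected_on_def by blast
  moreover have "connected_on E ((V \<union> W) - {x})" for x
  proof -
    obtain c where "c \<in> V \<inter> W" "c \<noteq> x"
      using ab by metis
    then have "connected_on E ((V - {x}) \<union> (W - {x}))"
      using two_connected_on_connected_Diff[OF V] two_connected_on_connected_Diff[OF W]
      by (intro connected_on_Un[of _ _ _ c]) auto
    then show ?thesis by (simp add: Un_Diff)
  qed
  ultimately show ?thesis
    unfolding two_connected_on_def by auto
qed

lemma connected_on_singleton: "connected_on E {x}"
  unfolding connected_on_def by simp

text \<open>Deleting one end leaves a single vertex, which counts as connected. Hence edges, too,
  extend to blocks.\<close>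

lemma two_connected_on_edge:
  assumes "{u, v} \<in> E" "u \<noteq> v"
  shows "two_connected_on E {u, v}"
proof -
  have "connected_on E {u, v}"
    using assms by (intro connected_onI[of u]) (auto simp: adj_on_def insert_commute)
  moreover have "connected_on E ({u, v} - {x})" if "x \<in> {u, v}" for x
  proof -
    have "{u, v} - {x} = {u} \<or> {u, v} - {x} = {v}"
      using that assms by auto
    then show ?thesis using connected_on_singleton by metis
  qed
  ultimately show ?thesis
    using assms unfolding two_connected_on_def by auto
qed

lemma two_connected_on_subset_block:
  assumes "two_connected_on E V" "V \<subseteq> {0..<n}"
  shows "\<exists>B \<in> blocks n E. V \<subseteq> B"
proof -
  define S where "S = {W. V \<subseteq> W \<and> W \<subseteq> {0..<n} \<and> two_connected_on E W}"
  have "finite S"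
    by (rule finite_subset[of _ "Pow {0..<n}"]) (auto simp: S_def)
  moreover have "S \<noteq> {}" using assms unfolding S_def by blast
  ultimately obtain B where "B \<in> S" and maximal: "\<And>W. W \<in> S \<Longrightarrow> B \<subseteq> W \<Longrightarrow> B = W"
    using finite_has_maximal[of S] by blast
  then have B: "V \<subseteq> B" "B \<subseteq> {0..<n}" "two_connected_on E B" unfolding S_def by auto
  have "\<not> two_connected_on E W" if "B \<subset> W" "W \<subseteq> {0..<n}" for W
  proof
    assume "two_connected_on E W"
    then have "W \<in> S" using B that by (auto simp: S_def)
    then show False using maximal[of W] that by auto
  qed
  then have "B \<in> blocks n E"
    using B unfolding blocks_def is_block_def by auto
  then show ?thesis using B by auto
qed

text \<open>Two distinct shared vertices make \<open>B \<union> C\<close> 2-connected, so by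
  maximality neither block is properly contained in the union.\<close>

lemma blocks_eqI:
  assumes "B \<in> blocks n E" "C \<in> blocks n E" "a \<in> B \<inter> C" "b \<in> B \<inter> C" "a \<noteq> b"
  shows "B = C"
proof -
  have B: "two_connected_on E B" "B \<subseteq> {0..<n}" "\<And>W. B \<subset> W \<Longrightarrow> W \<subseteq> {0..<n} \<Longrightarrow> \<not> two_connected_on E W"
    using assms(1) unfolding blocks_def is_block_def by auto
  have C: "two_connected_on E C" "C \<subseteq> {0..<n}" "\<And>W. C \<subset> W \<Longrightarrow> W \<subseteq> {0..<n} \<Longrightarrow> \<not> two_connected_on E W"
    using assms(2) unfolding blocks_def is_block_def by auto
  have "two_connected_on E (B \<union> C)" "B \<union> C \<subseteq> {0..<n}"
    using two_connected_on_Un[OF B(1) C(1) assms(3-5)] B(2) C(2) by auto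
  then have "\<not> B \<subset> B \<union> C" "\<not> C \<subset> B \<union> C"
    using B(3) C(3) by auto
  then show ?thesis by blast
qed

text \<open>Among the connected subsets of \<open>U\<close> containing two neighbours of \<open>x\<close>, one of least size
  plays the role of a shortest path: together with \<open>x\<close> it behaves like a cycle.\<close>
lemma two_connected_on_two_neighbours:
  assumes U: "finite U" "connected_on E U" and x: "x \<notin> U"
    and ab: "a \<in> U" "b \<in> U" "a \<noteq> b" "{x, a} \<in> E" "{x, b} \<in> E"
  shows "\<exists>P \<subseteq> U. connected_on E P \<and> card P \<ge> 2 \<and> two_connected_on E (insert x P)"
proof -
  let ?Q = "\<lambda>P. P \<subseteq> U \<and> connected_on E P \<and>
    (\<exists>a\<in>P. \<exists>b\<in>P. a \<noteq> b \<and> {x, a} \<in> E \<and> {x, b} \<in> E)"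
  have "?Q U" using U ab by blast
  then obtain P where P: "?Q P" and least: "\<And>R. ?Q R \<Longrightarrow> card P \<le> card R"
    using ex_has_least_nat[of ?Q U card] by blast
  obtain a b where ab: "a \<in> P" "b \<in> P" "a \<noteq> b" "{x, a} \<in> E" "{x, b} \<in> E"
    using P by blast
  have finP: "finite P" using P U finite_subset by blast
  have xP: "x \<notin> P" using P x by blast
  have con: "connected_on E (insert x P)"
  proof -
    have "connected_on E {x, a}"
      using two_connected_on_edge[of x a E] ab xP unfolding two_connected_on_def by blast
    then have "connected_on E ({x, a} \<union> P)"
      using P ab by (intro connected_on_Un[of _ _ _ a]) auto
    then show ?thesis using ab by (simp add: insert_absorb)
  qed
  have del: "connected_on E (insert x P - {y})" if y: "y \<in> P" for y
  proof -
    let ?R = "insert x (P - {y})"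
    \<comment> \<open>\<open>K\<close> collects the vertices that still reach \<open>x\<close> once
      \<open>y\<close> is deleted. With \<open>y\<close> added it has the property for which
      \<open>P\<close> is least, so it exhausts \<open>P\<close>.\<close>
    define K where "K = {z \<in> P - {y}. (z, x) \<in> (adj_on E ?R)\<^sup>*}"
    have nbr: "z \<in> K" if "z \<in> P" "z \<noteq> y" "{x, z} \<in> E" for z
    proof -
      have "(z, x) \<in> adj_on E ?R"
        using that by (auto simp: adj_on_def insert_commute)
      then show ?thesis using that unfolding K_def by blast
    qed
    have "connected_on E (insert y K)"
    proof (rule connected_onI[of y])
      fix v assume v: "v \<in> insert y K"
      then have "v \<in> P" using y unfolding K_def by blast
      \<comment> \<open>A path in \<open>P\<close> from a vertex of \<open>K\<close> to
        \<open>y\<close> stays in \<open>K\<close> until it hits \<open>y\<close>, because a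
        neighbour other than \<open>y\<close> of a vertex reaching \<open>x\<close> reaches
        \<open>x\<close> as well.\<close>
      then have "(v, y) \<in> (adj_on E P)\<^sup>*"
        using P y unfolding connected_on_def by blast
      then show "(v, y) \<in> (adj_on E (insert y K))\<^sup>*" using v
      proof (induction rule: converse_rtrancl_induct)
        case base
        show ?case by simp
      next
        case (step v z)
        show ?case
        proof (cases "v = y")
          case False
          have z: "z \<in> P" "v \<in> P" "{v, z} \<in> E"
            using step.hyps unfolding adj_on_def by auto
          have "z \<in> insert y K"
          proof (cases "z = y")
            case zy: False
            have "(z, v) \<in> adj_on E ?R"
              using z zy False unfolding adj_on_def by (auto simp: insert_commute)
            moreover have "(v, x) \<in> (adj_on E ?R)\<^sup>*"
              using False step.prems unfolding K_def by blast
            ultimately have "(z, x) \<in> (adj_on E ?R)\<^sup>*" by (rule converse_rtrancl_into_rtrancl)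
            then show ?thesis using z zy unfolding K_def by blast
          qed simp
          then have "(v, z) \<in> adj_on E (insert y K)" "(z, y) \<in> (adj_on E (insert y K))\<^sup>*"
            using step z unfolding adj_on_def by auto
          then show ?thesis by (rule converse_rtrancl_into_rtrancl)
        qed simp
      qed
    qed simp
    moreover have "insert y K \<subseteq> P" using y unfolding K_def by blast
    moreover have "a \<in> insert y K" "b \<in> insert y K" using nbr ab by blast+
    ultimately have "?Q (insert y K)" using P ab by blast
    then have "insert y K = P"
      using least finP \<open>insert y K \<subseteq> P\<close> card_seteq by metis
    then have "connected_on E ?R"
      unfolding K_def by (intro connected_onI[of x]) auto
    moreover have "?R = insert x P - {y}" using xP y by blast
    ultimately show ?thesis by simp
  qed
  have "card {a, b} \<le> card P"
    using ab finP by (intro card_mono) auto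
  then have card: "card P \<ge> 2" using ab by simp
  have "card P \<le> card (insert x P)" using finP by (intro card_mono) auto
  moreover have "connected_on E (insert x P - {x})" using P xP by simp
  ultimately have "two_connected_on E (insert x P)"
    using con del card finP unfolding two_connected_on_def by auto
  then show ?thesis using P card by blast
qed

section \<open>Traversal of the block tree\<close>

lemma finite_blocks: "finite (blocks n E)"
  by (rule finite_subset[of _ "Pow {0..<n}"]) (auto simp: blocks_def is_block_def)

text \<open>A traversal of the block tree from the root \<open>B0\<close>: every other block \<open>B\<close> loses the vertex
  by which it hangs on the part traversed before it.\<close>
lemma block_graph_partition:
  assumes bg: "block_graph n E" and B0: "B0 \<in> blocks n E"
  obtains p where "p B0 = B0" "\<forall>B \<in> blocks n E - {B0}. \<exists>v\<in>B. p B = B - {v}"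
    "disjoint_family_on p (blocks n E)" "(\<Union>B\<in>blocks n E. p B) = {0..<n}"
proof -
  let ?Bs = "blocks n E"
  \<comment> \<open>The invariant of a partial traversal \<open>F\<close>. Its last clause, that
    every edge inside \<open>\<Union>F\<close> lies in a block of \<open>F\<close>, is what later
    identifies a block as already traversed.\<close>
  define Inv where "Inv F p \<longleftrightarrow> F \<subseteq> ?Bs \<and> B0 \<in> F \<and> p B0 = B0 \<and>
     (\<forall>B \<in> F - {B0}. \<exists>v \<in> B. p B = B - {v}) \<and> disjoint_family_on p F \<and>
     (\<Union>B\<in>F. p B) = \<Union>F \<and> connected_on E (\<Union>F) \<and>
     (\<forall>a\<in>\<Union>F. \<forall>b\<in>\<Union>F. a \<noteq> b \<longrightarrow> {a, b} \<in> E \<longrightarrow> (\<exists>B\<in>F. a \<in> B \<and> b \<in> B))"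
    for F and p :: "nat set \<Rightarrow> nat set"
  have sub: "B \<subseteq> {0..<n}" and con: "connected_on E B" and card2: "card B \<ge> 2"
    if "B \<in> ?Bs" for B
    using that unfolding blocks_def is_block_def two_connected_on_def by auto
  have clique: "{a, b} \<in> E" if "B \<in> ?Bs" "a \<in> B" "b \<in> B" "a \<noteq> b" for B a b
    using that bg unfolding block_graph_def by blast
  have conV: "connected_on E {0..<n}" using bg unfolding block_graph_def by blast
  have "Inv {B0} (\<lambda>_. B0)"
    unfolding Inv_def using B0 con by (auto simp: disjoint_family_on_def)
  then have ex: "\<exists>p. Inv {B0} p" by blast
  have fin: "finite {F. \<exists>p. Inv F p}"
    by (rule finite_subset[of _ "Pow ?Bs"]) (auto simp: Inv_def finite_blocks)
  obtain F where F: "\<exists>p. Inv F p" and maxF: "\<And>F'. \<exists>p. Inv F' p \<Longrightarrow> F \<subseteq> F' \<Longrightarrow> F = F'"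
    using finite_has_maximal[OF fin] ex by blast
  obtain p where p: "Inv F p" using F by blast
  let ?U = "\<Union>F"
  have FB: "F \<subseteq> ?Bs" and B0F: "B0 \<in> F" and pB0: "p B0 = B0"
    and pv: "\<And>B. B \<in> F - {B0} \<Longrightarrow> \<exists>v \<in> B. p B = B - {v}"
    and dis: "disjoint_family_on p F" and Un: "(\<Union>B\<in>F. p B) = ?U" and conU: "connected_on E ?U"
    and edges: "\<And>a b. a \<in> ?U \<Longrightarrow> b \<in> ?U \<Longrightarrow> a \<noteq> b \<Longrightarrow> {a, b} \<in> E \<Longrightarrow> \<exists>B\<in>F. a \<in> B \<and> b \<in> B"
    using p unfolding Inv_def by auto
  have Usub: "?U \<subseteq> {0..<n}" using FB sub by blast
  have B0ne: "B0 \<noteq> {}" using card2[OF B0] by auto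
  \<comment> \<open>A connected set with two vertices contains an edge. By the invariant this edge
    lies in a traversed block, and sharing both its ends makes that block equal to
    \<open>C\<close>.\<close>
  have in_F: "C \<in> F" if "C \<in> ?Bs" "P \<subseteq> C" "P \<subseteq> ?U" "connected_on E P" "card P \<ge> 2" for C P
  proof -
    obtain a b where ab: "a \<in> P" "b \<in> P" "a \<noteq> b"
      using \<open>card P \<ge> 2\<close> by (meson card_2_iff' obtain_subset_with_card_n subset_iff)
    obtain b where b: "b \<in> P" "b \<noteq> a" "{a, b} \<in> E"
      using connected_on_ex_edge[OF \<open>connected_on E P\<close>] ab by blast
    obtain D where "D \<in> F" "a \<in> D" "b \<in> D"
      using edges[of a b] ab b \<open>P \<subseteq> ?U\<close> by blast
    then have "C = D"
      using blocks_eqI[of C n E D a b] ab b FB that by blast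
    then show ?thesis using \<open>D \<in> F\<close> by simp
  qed
  \<comment> \<open>Two neighbours of \<open>x\<close> in \<open>?U\<close> would put
    \<open>x\<close> into a 2-connected set whose other vertices lie in \<open>?U\<close>. By
    \<open>in_F\<close> the block around it would be traversed, although \<open>x\<close> is
    not.\<close>
  have one_nbr: "a = b"
    if x: "x \<in> {0..<n} - ?U" and ab: "a \<in> ?U" "b \<in> ?U" "{x, a} \<in> E" "{x, b} \<in> E" for x a b
  proof (rule ccontr)
    assume "a \<noteq> b"
    then obtain P where P: "P \<subseteq> ?U" "connected_on E P" "card P \<ge> 2" "two_connected_on E (insert x P)"
      using two_connected_on_two_neighbours[of ?U E x a b] x ab conU finite_subset[OF Usub] by auto
    obtain C where C: "C \<in> ?Bs" "insert x P \<subseteq> C"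
      using two_connected_on_subset_block[OF P(4), of n] P x Usub by auto
    then have "C \<in> F" using in_F P by blast
    then show False using C x by blast
  qed
  have "?U = {0..<n}"
  proof (rule ccontr)
    assume "?U \<noteq> {0..<n}"
    then obtain y where "y \<in> {0..<n}" "y \<notin> ?U" using Usub by blast
    moreover obtain z where "z \<in> ?U" "z \<in> {0..<n}" using B0F B0ne Usub by blast
    ultimately obtain u x where ux: "u \<in> ?U" "x \<in> {0..<n}" "x \<notin> ?U" "{u, x} \<in> E"
      using connected_on_edge_cut[OF conV, of z ?U y] by blast
    have une: "u \<noteq> x" using ux by blast
    obtain B where B: "B \<in> ?Bs" "{u, x} \<subseteq> B"
      using two_connected_on_subset_block[OF two_connected_on_edge[OF ux(4) une], of n] ux Usub by blast
    \<comment> \<open>Every other vertex of the clique \<open>B\<close> is adjacent to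
      \<open>x\<close>, so \<open>one_nbr\<close> leaves only \<open>u\<close>: the new block hangs
      on the traversed part by \<open>u\<close> alone.\<close>
    have BU: "B \<inter> ?U = {u}"
    proof (intro equalityI subsetI)
      fix w assume "w \<in> B \<inter> ?U"
      then show "w \<in> {u}"
        using one_nbr[of x w u] ux clique[OF B(1), of x w] B by (auto simp: insert_commute)
    qed (use B ux in blast)
    have BF: "B \<notin> F" using B ux by blast
    have "Inv (insert B F) (p(B := B - {u}))"
      unfolding Inv_def
    proof (intro conjI ballI impI)
      show "insert B F \<subseteq> ?Bs" "B0 \<in> insert B F" using B FB B0F by auto
      show "(p(B := B - {u})) B0 = B0" using pB0 BF B0F by auto
    next
      fix C assume "C \<in> insert B F - {B0}"
      then show "\<exists>v\<in>C. (p(B := B - {u})) C = C - {v}"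
        using pv[of C] B BF by (cases "C = B") auto
    next
      have old: "p C \<inter> (B - {u}) = {}" if "C \<in> F" for C
        using that BU Un by blast
      show "disjoint_family_on (p(B := B - {u})) (insert B F)"
        using dis old BF unfolding disjoint_family_on_def by (auto simp: Int_commute)
    next
      have "(\<Union>C\<in>insert B F. (p(B := B - {u})) C) = (B - {u}) \<union> (\<Union>C\<in>F. p C)"
        using BF by auto
      then show "(\<Union>C\<in>insert B F. (p(B := B - {u})) C) = \<Union>(insert B F)"
        using Un ux B by auto
    next
      show "connected_on E (\<Union>(insert B F))"
        using connected_on_Un[OF con[OF B(1)] conU, of u] B ux by auto
    next
      \<comment> \<open>Adding \<open>B\<close> creates no edge outside the blocks: \<open>b\<close>
        would have both \<open>a\<close> and \<open>u\<close> as neighbours in \<open>?U\<close>,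
        and these would have to coincide.\<close>
      have mixed: False if "a \<in> ?U" "a \<notin> B" "b \<in> B" "b \<notin> ?U" "{a, b} \<in> E" for a b
      proof -
        have "u \<noteq> b" "{b, u} \<in> E" "b \<in> {0..<n} - ?U"
          using that ux clique[OF B(1), of b u] B sub[OF B(1)] by blast+
        then have "a = u"
          using one_nbr[of b a u] that(1,5) ux(1) by (simp add: insert_commute)
        then show False using that B by blast
      qed
      fix a b assume ab: "a \<in> \<Union>(insert B F)" "b \<in> \<Union>(insert B F)" "a \<noteq> b" "{a, b} \<in> E"
      show "\<exists>C\<in>insert B F. a \<in> C \<and> b \<in> C"
      proof (cases "a \<in> B \<and> b \<in> B")
        case False
        have "{b, a} \<in> E" using ab by (simp add: insert_commute)
        then have "a \<in> ?U \<and> b \<in> ?U"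
          using ab False mixed[of a b] mixed[of b a] by blast
        then show ?thesis using edges[of a b] ab by blast
      qed blast
    qed
    then have "F = insert B F" using maxF by blast
    then show False using BF by blast
  qed
  moreover have "F = ?Bs"
  proof (intro equalityI FB subsetI)
    fix C assume "C \<in> ?Bs"
    then show "C \<in> F" using in_F[of C C] sub con card2 \<open>?U = {0..<n}\<close> by blast
  qed
  ultimately show ?thesis
    using that[of p] pB0 pv dis Un by auto
qed

section \<open>Perturbation of a diagonal matrix with prescribed spectrum\<close>

text \<open>Banach's fixed point theorem on a closed ball for the supremum norm, with pointwise
  bounds in place of a norm. The iterates from 0 stay in the ball, and the bound on their tails
  halves at each step.\<close>

lemma sup_contraction_fixpoint:
  fixes F :: "('a \<Rightarrow> real) \<Rightarrow> 'a \<Rightarrow> real"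
  assumes r: "r \<ge> 0"
    and self: "\<And>f. \<forall>x. \<bar>f x\<bar> \<le> r \<Longrightarrow> \<forall>x. \<bar>F f x\<bar> \<le> r"
    and contr: "\<And>f g e. \<forall>x. \<bar>f x\<bar> \<le> r \<Longrightarrow> \<forall>x. \<bar>g x\<bar> \<le> r \<Longrightarrow> \<forall>x. \<bar>f x - g x\<bar> \<le> e \<Longrightarrow>
      \<forall>x. \<bar>F f x - F g x\<bar> \<le> e / 2"
  shows "\<exists>f. (\<forall>x. \<bar>f x\<bar> \<le> r) \<and> F f = f"
proof -
  define f where "f k = (F ^^ k) (\<lambda>_. 0)" for k
  have f_Suc: "f (Suc k) = F (f k)" for k by (simp add: f_def)
  have bound: "\<forall>x. \<bar>f k x\<bar> \<le> r" for k
    by (induction k) (use r self f_Suc in \<open>auto simp: f_def\<close>)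
  have diff: "\<forall>x. \<bar>f (k + m) x - f k x\<bar> \<le> r * (1/2) ^ k" for k m
  proof (induction k)
    case 0
    show ?case using bound by (simp add: f_def)
  next
    case (Suc k)
    show ?case using contr[OF bound bound Suc] by (simp add: f_Suc mult.commute)
  qed
  have pow: "(\<lambda>k. r * (1/2) ^ k) \<longlonglongrightarrow> 0"
    using LIMSEQ_power_zero[of "1/2 :: real"] tendsto_mult_right_zero by fastforce
  have "Cauchy (\<lambda>k. f k x)" for x
  proof (rule CauchyI')
    fix e :: real assume "e > 0"
    then have "\<forall>\<^sub>F k in sequentially. r * (1/2) ^ k < e"
      using pow order_tendstoD(2) by blast
    then obtain N where N: "\<And>k. k \<ge> N \<Longrightarrow> r * (1/2) ^ k < e"
      unfolding eventually_sequentially by blast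
    show "\<exists>M. \<forall>m\<ge>M. \<forall>k>m. dist (f m x) (f k x) < e"
    proof (intro exI allI impI)
      fix m k assume "m \<ge> N" "k > m"
      then show "dist (f m x) (f k x) < e"
        using diff[of m "k - m"] N[of m] by (auto simp: dist_real_def abs_minus_commute intro: le_less_trans)
    qed
  qed
  then obtain g where g: "\<And>x. (\<lambda>k. f k x) \<longlonglongrightarrow> g x"
    unfolding Cauchy_convergent_iff convergent_def by metis
  have g_bound: "\<forall>x. \<bar>g x\<bar> \<le> r"
  proof
    fix x show "\<bar>g x\<bar> \<le> r"
      using tendsto_rabs[OF g[of x]] bound by (intro LIMSEQ_le_const2) auto
  qed
  have g_diff: "\<forall>x. \<bar>g x - f k x\<bar> \<le> r * (1/2) ^ k" for k
  proof
    fix x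
    have "(\<lambda>m. \<bar>f (k + m) x - f k x\<bar>) \<longlonglongrightarrow> \<bar>g x - f k x\<bar>"
      using LIMSEQ_ignore_initial_segment[OF g[of x], of k]
      by (intro tendsto_intros) (simp add: add.commute)
    then show "\<bar>g x - f k x\<bar> \<le> r * (1/2) ^ k"
      using diff by (intro LIMSEQ_le_const2) auto
  qed
  have "F g x = g x" for x
  proof (rule LIMSEQ_unique)
    show "(\<lambda>k. f (Suc k) x) \<longlonglongrightarrow> g x" using g by (rule LIMSEQ_Suc)
    have "\<bar>f (Suc k) x - F g x\<bar> \<le> r * (1/2) ^ k" for k
    proof -
      have "\<bar>F (f k) x - F g x\<bar> \<le> r * (1/2) ^ k / 2"
        using contr[OF bound g_bound, of k "r * (1/2) ^ k"] g_diff[of k]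
        by (simp add: abs_minus_commute)
      moreover have "r * (1/2) ^ k \<ge> 0" using r by simp
      ultimately show ?thesis unfolding f_Suc by linarith
    qed
    then have "(\<lambda>k. f (Suc k) x - F g x) \<longlonglongrightarrow> 0"
      using pow by (intro tendsto_rabs_zero_cancel[OF tendsto_sandwich[OF _ _ tendsto_const pow]]) auto
    then show "(\<lambda>k. f (Suc k) x) \<longlonglongrightarrow> F g x"
      by (simp add: LIM_zero_iff)
  qed
  then show ?thesis using g_bound by blast
qed

section \<open>Entrywise bounds\<close>

lemma ex_entry_bound:
  fixes f :: "nat \<Rightarrow> nat \<Rightarrow> real"
  shows "\<exists>w\<ge>0. \<forall>i<n. \<forall>j<n. \<bar>f i j\<bar> \<le> w"
proof (intro exI conjI allI impI)
  let ?w = "\<Sum>i<n. \<Sum>j<n. \<bar>f i j\<bar>"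
  show "0 \<le> ?w" by (intro sum_nonneg) auto
  fix i j assume ij: "i < n" "j < n"
  have "\<bar>f i j\<bar> \<le> (\<Sum>j<n. \<bar>f i j\<bar>)"
    using ij by (intro member_le_sum) auto
  also have "\<dots> \<le> ?w"
    using ij by (intro member_le_sum[where f = "\<lambda>i. \<Sum>j<n. \<bar>f i j\<bar>"] sum_nonneg) auto
  finally show "\<bar>f i j\<bar> \<le> ?w" .
qed

lemma abs_sum_lessThan_le:
  fixes f :: "nat \<Rightarrow> real"
  assumes "\<And>l. l < n \<Longrightarrow> \<bar>f l\<bar> \<le> c"
  shows "\<bar>\<Sum>l<n. f l\<bar> \<le> real n * c"
proof -
  have "\<bar>\<Sum>l<n. f l\<bar> \<le> (\<Sum>l<n. \<bar>f l\<bar>)" by (rule sum_abs)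
  also have "\<dots> \<le> (\<Sum>l<n. c)" using assms by (intro sum_mono) auto
  finally show ?thesis by simp
qed

lemma abs_mult_le:
  fixes a b :: real
  shows "\<bar>a\<bar> \<le> x \<Longrightarrow> \<bar>b\<bar> \<le> y \<Longrightarrow> \<bar>a * b\<bar> \<le> x * y"
  by (simp add: abs_mult mult_mono')

text \<open>The largest absolute entry satisfies \<open>M \<le> q * M\<close>, which forces
  \<open>M = 0\<close>. This turns smallness of a perturbation into exact vanishing: of the skew
  part of \<open>B\<close>, of kernel vectors of \<open>I + Z\<close>, and of \<open>X\<close> in
  the strong spectral property.\<close>

lemma zero_if_self_bounded:
  fixes f :: "nat \<Rightarrow> nat \<Rightarrow> real"
  assumes q: "q < 1"
    and self: "\<And>M. M \<ge> 0 \<Longrightarrow> \<forall>i<n. \<forall>j<n. \<bar>f i j\<bar> \<le> M \<Longrightarrow> \<forall>i<n. \<forall>j<n. \<bar>f i j\<bar> \<le> q * M"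
    and ij: "i < n" "j < n"
  shows "f i j = 0"
proof -
  let ?S = "(\<lambda>(i, j). \<bar>f i j\<bar>) ` ({..<n} \<times> {..<n})"
  have fin: "finite ?S" by simp
  have ne: "?S \<noteq> {}" using ij by blast
  have le: "\<forall>i<n. \<forall>j<n. \<bar>f i j\<bar> \<le> Max ?S"
  proof (intro allI impI)
    fix a b assume "a < n" "b < n"
    then have "\<bar>f a b\<bar> \<in> ?S" by force
    then show "\<bar>f a b\<bar> \<le> Max ?S" by (rule Max_ge[OF fin])
  qed
  obtain a b where ab: "a < n" "b < n" "Max ?S = \<bar>f a b\<bar>"
    using Max_in[OF fin ne] by auto
  have "Max ?S \<ge> 0" using ab by simp
  then have "\<bar>f a b\<bar> \<le> q * Max ?S" using self[of "Max ?S"] le ab by blast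
  then have "(1 - q) * Max ?S \<le> 0" using ab by (simp add: algebra_simps)
  then have "Max ?S \<le> 0" using q by (simp add: mult_le_0_iff)
  then show ?thesis using le ij by fastforce
qed

text \<open>The equation for \<open>Z\<close> is the part off the diagonal blocks of \<open>(C + tW)(I + Z) = (I + Z)D\<close>,
  where \<open>D = diag d\<close>, the blocks are the level sets of \<open>d\<close>, and the block diagonal matrix \<open>C\<close> has
  been eliminated by means of the diagonal blocks of the same identity.\<close>
lemma ex_block_eigenvectors:
  fixes d :: "nat \<Rightarrow> real" and W :: "nat \<Rightarrow> nat \<Rightarrow> real"
  shows "\<exists>K\<ge>0. \<exists>t0>0. \<forall>t. 0 < t \<and> t \<le> t0 \<longrightarrow> (\<exists>Z :: nat \<Rightarrow> nat \<Rightarrow> real.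
    (\<forall>i j. \<bar>Z i j\<bar> \<le> K * t) \<and> (\<forall>i j. d i = d j \<longrightarrow> Z i j = 0) \<and>
    (\<forall>i<n. \<forall>j<n. d i \<noteq> d j \<longrightarrow> \<bar>Z i j - t * W i j / (d j - d i)\<bar> \<le> K * t\<^sup>2) \<and>
    (\<forall>i<n. \<forall>j<n. d i \<noteq> d j \<longrightarrow> (d j - d i) * Z i j = t * (W i j + ((\<Sum>l<n. W i l * Z l j) -
       (\<Sum>l<n. (if d l = d i then \<Sum>k<n. W i k * Z k l else 0) * Z l j)))))"
proof -
  obtain w where w: "w \<ge> 0" "\<And>i j. i < n \<Longrightarrow> j < n \<Longrightarrow> \<bar>W i j\<bar> \<le> w"
    using ex_entry_bound[of n W] by blast
  \<comment> \<open>Since \<open>1 / 0 = 0\<close>, equal labels do no harm here.\<close>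
  obtain g where g: "g \<ge> 0" "\<And>i j. i < n \<Longrightarrow> j < n \<Longrightarrow> \<bar>1 / (d j - d i)\<bar> \<le> g"
    using ex_entry_bound[of n "\<lambda>i j. 1 / (d j - d i)"] by blast
  let ?n = "real n"
  \<comment> \<open>\<open>P\<close> holds the diagonal blocks of \<open>WZ\<close>, and
    \<open>Q\<close> is \<open>WZ - PZ\<close>. The equation for \<open>Z\<close> becomes the fixed
    point equation \<open>Z = t * Psi Z\<close>, with \<open>Psi\<close> set to 0 on the diagonal
    blocks.\<close>
  define P where "P Z i l = (if d l = d i then \<Sum>k<n. W i k * Z (k, l) else 0)"
    for Z :: "nat \<times> nat \<Rightarrow> real" and i l
  define Q where "Q Z i j = (\<Sum>l<n. W i l * Z (l, j)) - (\<Sum>l<n. P Z i l * Z (l, j))"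
    for Z :: "nat \<times> nat \<Rightarrow> real" and i j
  define Psi where "Psi Z = (\<lambda>(i, j). if i < n \<and> j < n \<and> d i \<noteq> d j
    then (W i j + Q Z i j) * (1 / (d j - d i)) else 0)" for Z :: "nat \<times> nat \<Rightarrow> real"
  \<comment> \<open>\<open>q\<close> is a Lipschitz constant of \<open>Q\<close> on the unit ball:
    one summand from the linear term, and two equal ones from splitting the difference of the
    products \<open>PZ\<close>. \<open>L\<close> is the corresponding constant for
    \<open>Psi\<close>, and \<open>K0\<close> bounds \<open>Psi\<close> itself.\<close>
  define q where "q = ?n * w + 2 * ?n * (?n * w)"
  define L where "L = q * g"
  define K0 where "K0 = w * g + L"
  have nonneg: "q \<ge> 0" "L \<ge> 0" "K0 \<ge> 0" "K0 \<ge> L"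
    using w g by (simp_all add: q_def L_def K0_def)
  have P_diff: "\<bar>P Z i l - P Z' i l\<bar> \<le> ?n * (w * e)"
    if "\<forall>x. \<bar>Z x - Z' x\<bar> \<le> e" "i < n" for Z Z' e i l
  proof -
    have "e \<ge> 0" using that(1) abs_ge_zero order_trans by blast
    moreover have "\<bar>\<Sum>k<n. W i k * (Z (k, l) - Z' (k, l))\<bar> \<le> ?n * (w * e)"
      using that w by (intro abs_sum_lessThan_le abs_mult_le) auto
    ultimately show ?thesis
      using w by (simp add: P_def right_diff_distrib sum_subtractf)
  qed
  have Q_diff: "\<bar>Q Z i j - Q Z' i j\<bar> \<le> q * e"
    if Z: "\<forall>x. \<bar>Z x\<bar> \<le> 1" and Z': "\<forall>x. \<bar>Z' x\<bar> \<le> 1" and e: "\<forall>x. \<bar>Z x - Z' x\<bar> \<le> e" and "i < n"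
    for Z Z' e i j
  proof -
    have P0: "\<bar>P Z i l\<bar> \<le> ?n * (w * 1)" for l
      using P_diff[of Z "\<lambda>_. 0" 1 i l] Z \<open>i < n\<close> by (auto simp: P_def split: if_splits)
    have "Q Z i j - Q Z' i j = (\<Sum>l<n. W i l * (Z (l, j) - Z' (l, j)))
       - (\<Sum>l<n. P Z i l * (Z (l, j) - Z' (l, j))) - (\<Sum>l<n. (P Z i l - P Z' i l) * Z' (l, j))"
      unfolding Q_def sum_subtractf[symmetric] by (simp add: algebra_simps sum.distrib sum_subtractf)
    moreover have "\<bar>\<Sum>l<n. W i l * (Z (l, j) - Z' (l, j))\<bar> \<le> ?n * (w * e)"
      using e w \<open>i < n\<close> by (intro abs_sum_lessThan_le abs_mult_le) auto
    moreover have "\<bar>\<Sum>l<n. P Z i l * (Z (l, j) - Z' (l, j))\<bar> \<le> ?n * ((?n * (w * 1)) * e)"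
      using e P0 by (intro abs_sum_lessThan_le abs_mult_le) auto
    moreover have "\<bar>\<Sum>l<n. (P Z i l - P Z' i l) * Z' (l, j)\<bar> \<le> ?n * ((?n * (w * e)) * 1)"
      using P_diff[OF e \<open>i < n\<close>] Z' by (intro abs_sum_lessThan_le abs_mult_le) auto
    ultimately show ?thesis by (simp add: q_def algebra_simps)
  qed
  have Psi_diff: "\<bar>Psi Z x - Psi Z' x\<bar> \<le> L * e"
    if "\<forall>x. \<bar>Z x\<bar> \<le> 1" "\<forall>x. \<bar>Z' x\<bar> \<le> 1" "\<forall>x. \<bar>Z x - Z' x\<bar> \<le> e" for Z Z' e x
  proof -
    have e: "e \<ge> 0" using that(3) abs_ge_zero order_trans by blast
    obtain i j where x: "x = (i, j)" by fastforce
    show ?thesis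
    proof (cases "i < n \<and> j < n \<and> d i \<noteq> d j")
      case True
      then have "\<bar>(Q Z i j - Q Z' i j) * (1 / (d j - d i))\<bar> \<le> q * e * g"
        using Q_diff[OF that] g by (intro abs_mult_le) auto
      then show ?thesis using True x by (simp add: Psi_def L_def algebra_simps diff_divide_distrib[symmetric])
    next
      case False
      then show ?thesis using x e nonneg by (auto simp: Psi_def)
    qed
  qed
  have Psi0: "Psi (\<lambda>_. 0) (i, j) = (if i < n \<and> j < n \<and> d i \<noteq> d j then W i j / (d j - d i) else 0)" for i j
    by (simp add: Psi_def Q_def)
  have Psi0_bound: "\<bar>Psi (\<lambda>_. 0) x\<bar> \<le> w * g" for x
  proof -
    obtain i j where x: "x = (i, j)" by fastforce
    show ?thesis
    proof (cases "i < n \<and> j < n \<and> d i \<noteq> d j")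
      case True
      then have "\<bar>W i j * (1 / (d j - d i))\<bar> \<le> w * g" using w g by (intro abs_mult_le) auto
      then show ?thesis using True x by (simp add: Psi0)
    next
      case False
      then show ?thesis using x w g by (auto simp: Psi0)
    qed
  qed
  have Psi_bound: "\<bar>Psi Z x\<bar> \<le> K0" if "\<forall>x. \<bar>Z x\<bar> \<le> 1" for Z x
    using Psi_diff[of Z "\<lambda>_. 0" 1 x] Psi0_bound[of x] that by (auto simp: K0_def)
  \<comment> \<open>This makes \<open>t * K0 \<le> 1 / 2\<close>. As \<open>L \<le> K0\<close>, the
    map \<open>t * Psi\<close> then preserves the unit ball and contracts it by 1/2.\<close>
  define t0 where "t0 = 1 / (2 * (K0 + 1))"
  have t0: "t0 > 0" using nonneg by (simp add: t0_def)
  have main: "\<exists>Z :: nat \<Rightarrow> nat \<Rightarrow> real.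
    (\<forall>i j. \<bar>Z i j\<bar> \<le> (K0 + L * K0) * t) \<and> (\<forall>i j. d i = d j \<longrightarrow> Z i j = 0) \<and>
    (\<forall>i<n. \<forall>j<n. d i \<noteq> d j \<longrightarrow> \<bar>Z i j - t * W i j / (d j - d i)\<bar> \<le> (K0 + L * K0) * t\<^sup>2) \<and>
    (\<forall>i<n. \<forall>j<n. d i \<noteq> d j \<longrightarrow> (d j - d i) * Z i j = t * (W i j + ((\<Sum>l<n. W i l * Z l j) -
       (\<Sum>l<n. (if d l = d i then \<Sum>k<n. W i k * Z k l else 0) * Z l j))))"
    if t: "0 < t" "t \<le> t0" for t
  proof -
    have tK: "t * K0 \<le> 1 / 2"
    proof -
      have "t * K0 \<le> t0 * (K0 + 1)" using t nonneg t0 by (intro mult_mono) auto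
      also have "t0 * (K0 + 1) = 1 / 2" using nonneg by (simp add: t0_def field_simps)
      finally show ?thesis .
    qed
    then have tL: "t * L \<le> 1 / 2"
      using nonneg t mult_left_mono[of L K0 t] by linarith
    have "\<exists>Z. (\<forall>x. \<bar>Z x\<bar> \<le> 1) \<and> (\<lambda>x. t * Psi Z x) = Z"
    proof (rule sup_contraction_fixpoint)
      fix Z :: "nat \<times> nat \<Rightarrow> real" assume Z: "\<forall>x. \<bar>Z x\<bar> \<le> 1"
      show "\<forall>x. \<bar>t * Psi Z x\<bar> \<le> 1"
      proof
        fix x
        have "\<bar>t * Psi Z x\<bar> \<le> t * K0" using t Psi_bound[OF Z] by (intro abs_mult_le) auto
        then show "\<bar>t * Psi Z x\<bar> \<le> 1" using tK by simp
      qed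
    next
      fix Z Z' :: "nat \<times> nat \<Rightarrow> real" and e
      assume Z: "\<forall>x. \<bar>Z x\<bar> \<le> 1" "\<forall>x. \<bar>Z' x\<bar> \<le> 1" "\<forall>x. \<bar>Z x - Z' x\<bar> \<le> e"
      have e: "e \<ge> 0" using Z(3) abs_ge_zero order_trans by blast
      show "\<forall>x. \<bar>t * Psi Z x - t * Psi Z' x\<bar> \<le> e / 2"
      proof
        fix x
        have "\<bar>t * (Psi Z x - Psi Z' x)\<bar> \<le> t * (L * e)"
          using t Psi_diff[OF Z] by (intro abs_mult_le) auto
        moreover have "(t * L) * e \<le> (1 / 2) * e" using tL e by (rule mult_right_mono)
        ultimately show "\<bar>t * Psi Z x - t * Psi Z' x\<bar> \<le> e / 2" by (simp add: algebra_simps)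
      qed
    qed simp
    then obtain Z where Z: "\<forall>x. \<bar>Z x\<bar> \<le> 1" and fixp: "\<And>x. Z x = t * Psi Z x"
      by metis
    have Zt: "\<forall>x. \<bar>Z x\<bar> \<le> K0 * t"
    proof
      fix x
      have "\<bar>t * Psi Z x\<bar> \<le> t * K0" using t Psi_bound[OF Z] by (intro abs_mult_le) auto
      then show "\<bar>Z x\<bar> \<le> K0 * t" using fixp[of x] by (simp add: mult.commute)
    qed
    have LK: "0 \<le> L * K0 * t" "0 \<le> K0 * t\<^sup>2" using nonneg t by auto
    show ?thesis
    proof (intro exI[of _ "\<lambda>i j. Z (i, j)"] conjI allI impI)
      fix i j show "\<bar>Z (i, j)\<bar> \<le> (K0 + L * K0) * t"
        using Zt[rule_format, of "(i, j)"] LK by (simp add: algebra_simps)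
    next
      fix i j assume "d i = d j"
      then show "Z (i, j) = 0" using fixp[of "(i, j)"] by (simp add: Psi_def)
    next
      fix i j assume ij: "i < n" "j < n" "d i \<noteq> d j"
      \<comment> \<open>As \<open>Z\<close> has size at most \<open>K0 * t\<close>, replacing
        \<open>Psi Z\<close> by \<open>Psi\<close> at 0 in the fixed point equation costs only order
        \<open>t\<^sup>2\<close>; what remains is the first order term.\<close>
      have "\<bar>t * (Psi Z (i, j) - Psi (\<lambda>_. 0) (i, j))\<bar> \<le> t * (L * (K0 * t))"
        using t Psi_diff[OF Z, of "\<lambda>_. 0" "K0 * t"] Zt by (intro abs_mult_le) auto
      moreover have "t * (Psi Z (i, j) - Psi (\<lambda>_. 0) (i, j)) = Z (i, j) - t * W i j / (d j - d i)"
        using ij fixp[of "(i, j)"] by (simp add: Psi0 right_diff_distrib)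
      ultimately show "\<bar>Z (i, j) - t * W i j / (d j - d i)\<bar> \<le> (K0 + L * K0) * t\<^sup>2"
        using LK by (simp add: algebra_simps power2_eq_square)
    next
      fix i j assume ij: "i < n" "j < n" "d i \<noteq> d j"
      have "Z (i, j) = t * ((W i j + Q Z i j) * (1 / (d j - d i)))"
        using ij fixp[of "(i, j)"] by (simp add: Psi_def)
      then have "(d j - d i) * Z (i, j) = t * (W i j + Q Z i j)"
        using ij by (simp add: field_simps)
      then show "(d j - d i) * Z (i, j) = t * (W i j + ((\<Sum>l<n. W i l * Z (l, j)) -
         (\<Sum>l<n. (if d l = d i then \<Sum>k<n. W i k * Z (k, l) else 0) * Z (l, j))))"
        by (simp add: Q_def P_def)
    qed
  qed
  have "K0 + L * K0 \<ge> 0" using nonneg by simp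
  then show ?thesis
    using main t0 by (intro exI[of _ "K0 + L * K0"] conjI exI[of _ t0]) auto
qed

section \<open>Similarity to the diagonal matrix, symmetry, and the strong spectral property\<close>

lemma block_similarity:
  fixes d :: "nat \<Rightarrow> real" and W Z :: "nat \<Rightarrow> nat \<Rightarrow> real"
  assumes W0: "\<And>i j. d i = d j \<Longrightarrow> W i j = 0" and Z0: "\<And>i j. d i = d j \<Longrightarrow> Z i j = 0"
    and eq: "\<And>i j. i < n \<Longrightarrow> j < n \<Longrightarrow> d i \<noteq> d j \<Longrightarrow>
      (d j - d i) * Z i j = t * (W i j + ((\<Sum>l<n. W i l * Z l j) -
       (\<Sum>l<n. (if d l = d i then \<Sum>k<n. W i k * Z k l else 0) * Z l j)))"
    and B: "\<And>i j. B i j = (if d i = d j then (if i = j then d i else 0) - t * (\<Sum>k<n. W i k * Z k j) else t * W i j)"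
    and ij: "i < n" "j < n"
  shows "(\<Sum>l<n. B i l * ((if l = j then 1 else 0) + Z l j)) = ((if i = j then 1 else 0) + Z i j) * d j"
proof -
  let ?P = "\<lambda>l. if d l = d i then \<Sum>k<n. W i k * Z k l else 0"
  \<comment> \<open>Row \<open>i\<close> of \<open>B\<close> consists of \<open>d i\<close> on the
    diagonal, \<open>t * W\<close> and \<open>-t * ?P\<close>; the last two have disjoint
    supports.\<close>
  have "B i l * Z l j = (if l = i then d i * Z i j else 0) + t * (W i l * Z l j) - t * (?P l * Z l j)" for l
    by (auto simp: B W0 algebra_simps)
  then have "(\<Sum>l<n. B i l * Z l j) = (\<Sum>l<n. (if l = i then d i * Z i j else 0)) +
      t * (\<Sum>l<n. W i l * Z l j) - t * (\<Sum>l<n. ?P l * Z l j)"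
    by (simp add: sum.distrib sum_subtractf sum_distrib_left)
  also have "(\<Sum>l<n. (if l = i then d i * Z i j else 0)) = d i * Z i j"
    using ij by simp
  finally have BZ: "(\<Sum>l<n. B i l * Z l j) =
    d i * Z i j + t * (\<Sum>l<n. W i l * Z l j) - t * (\<Sum>l<n. ?P l * Z l j)" .
  have "(\<Sum>l<n. B i l * ((if l = j then 1 else 0) + Z l j)) =
      (\<Sum>l<n. if l = j then B i j else 0) + (\<Sum>l<n. B i l * Z l j)"
    unfolding sum.distrib[symmetric] by (intro sum.cong) (auto simp: algebra_simps)
  also have "(\<Sum>l<n. if l = j then B i j else 0) = B i j" using ij by simp
  finally have lhs: "(\<Sum>l<n. B i l * ((if l = j then 1 else 0) + Z l j)) = B i j +
    (d i * Z i j + t * (\<Sum>l<n. W i l * Z l j) - t * (\<Sum>l<n. ?P l * Z l j))"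
    unfolding BZ .
  show ?thesis
  proof (cases "d i = d j")
    case True
    then have "(\<Sum>l<n. ?P l * Z l j) = 0" using Z0 by (intro sum.neutral) auto
    then show ?thesis unfolding lhs using True Z0 by (auto simp: B)
  next
    case False
    then have "i \<noteq> j" by auto
    then show ?thesis unfolding lhs using False eq[OF ij False] by (simp add: B algebra_simps)
  qed
qed

text \<open>If \<open>BV = VD\<close> then \<open>V\<^sup>T(B - B\<^sup>T)V = HD - DH\<close> with \<open>H = V\<^sup>TV\<close>, which vanishes on the diagonal
  blocks; so the block diagonal matrix \<open>N = B - B\<^sup>T\<close> agrees on the diagonal blocks with
  \<open>-Z\<^sup>TNZ\<close>, which is smaller than \<open>N\<close> unless \<open>N = 0\<close>.\<close>
lemma block_symmetric:
  fixes d :: "nat \<Rightarrow> real" and B Z :: "nat \<Rightarrow> nat \<Rightarrow> real"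
  assumes Z0: "\<And>i j. d i = d j \<Longrightarrow> Z i j = 0"
    and sym: "\<And>i j. d i \<noteq> d j \<Longrightarrow> B i j = B j i"
    and sim: "\<And>i j. i < n \<Longrightarrow> j < n \<Longrightarrow>
      (\<Sum>l<n. B i l * ((if l = j then 1 else 0) + Z l j)) = ((if i = j then 1 else 0) + Z i j) * d j"
    and Ze: "\<And>i j. \<bar>Z i j\<bar> \<le> e" and e: "real n * e < 1"
    and ij: "i < n" "j < n"
  shows "B i j = B j i"
proof -
  define V where "V i j = (if i = j then 1 else 0) + Z i j" for i j
  define N where "N i j = B i j - B j i" for i j
  have e0: "e \<ge> 0" using Ze abs_ge_zero order_trans by blast
  have N0: "N i j = 0" if "d i \<noteq> d j" for i j using sym[OF that] by (simp add: N_def)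
  have sim': "(\<Sum>l<n. B i l * V l j) = V i j * d j" if "i < n" "j < n" for i j
    using sim[OF that] by (simp add: V_def)
  have N_eq: "N i j = - (\<Sum>k<n. \<Sum>l<n. (Z k i * N k l) * Z l j)" if ij: "i < n" "j < n" "d i = d j" for i j
  proof -
    \<comment> \<open>This is \<open>V\<^sup>TBV = V\<^sup>TVD\<close>. Its transpose carries the
      factor \<open>d i\<close> instead of \<open>d j\<close>, so the two agree where
      \<open>d i = d j\<close>.\<close>
    have 1: "(\<Sum>k<n. \<Sum>l<n. V k i * B k l * V l j) = (\<Sum>k<n. V k i * V k j) * d j" if "j < n" for i j
    proof -
      have "(\<Sum>k<n. \<Sum>l<n. V k i * B k l * V l j) = (\<Sum>k<n. V k i * (\<Sum>l<n. B k l * V l j))"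
        by (simp add: sum_distrib_left algebra_simps)
      also have "\<dots> = (\<Sum>k<n. V k i * (V k j * d j))"
        using sim' that by (intro sum.cong) auto
      finally show ?thesis by (simp add: sum_distrib_right mult.assoc)
    qed
    have "(\<Sum>k<n. \<Sum>l<n. V k i * B l k * V l j) = (\<Sum>l<n. \<Sum>k<n. V l j * B l k * V k i)"
      by (subst sum.swap) (simp add: algebra_simps)
    also have "\<dots> = (\<Sum>k<n. V k i * V k j) * d i"
      using 1[of i j] ij by (simp add: algebra_simps)
    finally have "(\<Sum>k<n. \<Sum>l<n. V k i * N k l * V l j) = 0"
      using 1[of j i] ij by (simp add: N_def right_diff_distrib left_diff_distrib sum_subtractf)
    moreover have "(\<Sum>l<n. V k i * N k l * V l j) = V k i * N k j + V k i * (\<Sum>l<n. N k l * Z l j)" for k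
    proof -
      have "(\<Sum>l<n. V k i * N k l * V l j) =
         (\<Sum>l<n. (if l = j then V k i * N k j else 0) + V k i * (N k l * Z l j))"
        by (intro sum.cong) (auto simp: V_def algebra_simps)
      then show ?thesis using ij by (simp add: sum.distrib sum_distrib_left)
    qed
    ultimately have 2: "(\<Sum>k<n. V k i * N k j) + (\<Sum>k<n. V k i * (\<Sum>l<n. N k l * Z l j)) = 0"
      by (simp add: sum.distrib)
    have NZ: "(\<Sum>l<n. N i l * Z l j) = 0"
    proof (intro sum.neutral ballI)
      fix l show "N i l * Z l j = 0"
        using N0[of i l] Z0[of l j] ij by (cases "d i = d l") auto
    qed
    \<comment> \<open>\<open>N\<close> vanishes off the diagonal blocks and \<open>V\<close> is the
      identity on them, so only \<open>k = i\<close> contributes.\<close>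
    have "(\<Sum>k<n. V k i * N k j) = (\<Sum>k<n. (if k = i then N i j else 0))"
    proof (intro sum.cong refl)
      fix k show "V k i * N k j = (if k = i then N i j else 0)"
        using N0[of k j] Z0[of k i] ij by (cases "d k = d j") (auto simp: V_def)
    qed
    then have 3: "(\<Sum>k<n. V k i * N k j) = N i j" using ij by simp
    \<comment> \<open>By \<open>NZ\<close> the identity part of \<open>V\<close> contributes
      nothing, which leaves \<open>Z\<close>.\<close>
    have "(\<Sum>k<n. V k i * (\<Sum>l<n. N k l * Z l j)) = (\<Sum>k<n. Z k i * (\<Sum>l<n. N k l * Z l j))"
      using NZ by (intro sum.cong) (auto simp: V_def algebra_simps)
    then show ?thesis using 2 3 by (simp add: sum_distrib_left mult.assoc)
  qed
  have "N i j = 0"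
  proof (rule zero_if_self_bounded[OF e _ ij])
    fix M assume M: "M \<ge> 0" "\<forall>i<n. \<forall>j<n. \<bar>N i j\<bar> \<le> M"
    show "\<forall>i<n. \<forall>j<n. \<bar>N i j\<bar> \<le> real n * e * M"
    proof (intro allI impI)
      fix i j assume ij: "i < n" "j < n"
      show "\<bar>N i j\<bar> \<le> real n * e * M"
      proof (cases "d i = d j")
        case True
        have "\<bar>\<Sum>k<n. \<Sum>l<n. (Z k i * N k l) * Z l j\<bar> \<le> real n * (real n * ((e * M) * e))"
          using Ze M by (intro abs_sum_lessThan_le abs_mult_le) auto
        also have "\<dots> = (real n * e) * (real n * e * M)" by simp
        also have "\<dots> \<le> 1 * (real n * e * M)"
          using e e0 M by (intro mult_right_mono) auto
        finally show ?thesis using N_eq[OF ij True] by simp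
      next
        case False
        then show ?thesis using N0 e0 M by simp
      qed
    qed
  qed
  then show ?thesis by (simp add: N_def)
qed

text \<open>\<open>sim\<close> reads \<open>B(I + Z) = (I + Z)D\<close>. A kernel vector of
  \<open>I + Z\<close> satisfies \<open>v = -Zv\<close>, impossible for nonzero \<open>v\<close>
  when \<open>Z\<close> is small, so \<open>B\<close> is similar to \<open>D\<close>.\<close>

lemma char_poly_of_diagonalization:
  fixes d :: "nat \<Rightarrow> real" and B Z :: "nat \<Rightarrow> nat \<Rightarrow> real"
  assumes sim: "\<And>i j. i < n \<Longrightarrow> j < n \<Longrightarrow>
      (\<Sum>l<n. B i l * ((if l = j then 1 else 0) + Z l j)) = ((if i = j then 1 else 0) + Z i j) * d j"
    and Ze: "\<And>i j. \<bar>Z i j\<bar> \<le> e" and e: "real n * e < 1"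
  shows "char_poly (mat n n (\<lambda>(i, j). B i j)) = (\<Prod>i<n. [:- d i, 1:])"
proof -
  define V where "V = mat n n (\<lambda>(i, j). (if i = j then 1 else 0) + Z i j)"
  define A where "A = mat n n (\<lambda>(i, j). B i j)"
  define D where "D = mat n n (\<lambda>(i, j). if i = j then d i else 0)"
  have carrier: "V \<in> carrier_mat n n" "A \<in> carrier_mat n n" "D \<in> carrier_mat n n"
    by (simp_all add: V_def A_def D_def)
  have AV: "A * V = V * D"
  proof (rule eq_matI)
    fix i j assume "i < dim_row (V * D)" "j < dim_col (V * D)"
    then have ij: "i < n" "j < n" using carrier by auto
    have "(A * V) $$ (i, j) = (\<Sum>l<n. B i l * ((if l = j then 1 else 0) + Z l j))"
      using ij by (simp add: A_def V_def scalar_prod_def atLeast0LessThan)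
    also have "\<dots> = (\<Sum>l<n. if l = j then ((if i = j then 1 else 0) + Z i j) * d j else 0)"
      using sim[OF ij] ij by simp
    also have "\<dots> = (\<Sum>l<n. ((if i = l then 1 else 0) + Z i l) * (if l = j then d l else 0))"
      by (intro sum.cong) auto
    also have "\<dots> = (V * D) $$ (i, j)"
      using ij by (simp add: D_def V_def scalar_prod_def atLeast0LessThan)
    finally show "(A * V) $$ (i, j) = (V * D) $$ (i, j)" .
  qed (use carrier in auto)
  have "det V \<noteq> 0"
  proof
    assume "det V = 0"
    then obtain v where v: "v \<in> carrier_vec n" "v \<noteq> 0\<^sub>v n" "V *\<^sub>v v = 0\<^sub>v n"
      using det_0_iff_vec_prod_zero[OF carrier(1)] by auto
    have vi: "v $ i = - (\<Sum>l<n. Z i l * v $ l)" if "i < n" for i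
    proof -
      have "0 = (V *\<^sub>v v) $ i" using v that by simp
      also have "\<dots> = (\<Sum>l<n. ((if i = l then 1 else 0) + Z i l) * v $ l)"
        using v(1) that by (simp add: V_def scalar_prod_def atLeast0LessThan)
      also have "\<dots> = (\<Sum>l<n. (if l = i then v $ i else 0) + Z i l * v $ l)"
        by (intro sum.cong) (auto simp: algebra_simps)
      also have "\<dots> = v $ i + (\<Sum>l<n. Z i l * v $ l)"
        using that by (simp add: sum.distrib)
      finally show ?thesis by simp
    qed
    \<comment> \<open>The vector is treated as a matrix constant in its second index.\<close>
    have "v $ i = 0" if "i < n" for i
    proof (rule zero_if_self_bounded[OF e _ that that, of "\<lambda>i _. v $ i"])
      fix M assume M: "\<forall>i<n. \<forall>j<n. \<bar>v $ i\<bar> \<le> M"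
      show "\<forall>i<n. \<forall>j<n. \<bar>v $ i\<bar> \<le> real n * e * M"
      proof (intro allI impI)
        fix i assume "i < n"
        have "\<bar>\<Sum>l<n. Z i l * v $ l\<bar> \<le> real n * (e * M)"
          using M Ze by (intro abs_sum_lessThan_le abs_mult_le) auto
        then show "\<bar>v $ i\<bar> \<le> real n * e * M" using vi[OF \<open>i < n\<close>] by simp
      qed
    qed
    then have "v = 0\<^sub>v n" using v by auto
    then show False using v by blast
  qed
  then obtain U where U: "U \<in> carrier_mat n n" "V * U = 1\<^sub>m n" "U * V = 1\<^sub>m n"
    using det_non_zero_imp_unit[OF carrier(1)] by (auto simp: Units_def ring_mat_def)
  have "A = A * (V * U)" using U carrier by simp
  also have "\<dots> = (A * V) * U" using U carrier by (simp add: assoc_mult_mat[of _ n n _ n _ n])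
  also have "\<dots> = V * D * U" using AV by simp
  finally have "similar_mat A D"
    using U carrier by (intro similar_matI[of _ _ V U n]) auto
  then have "char_poly A = char_poly D" by (rule char_poly_similar)
  also have "\<dots> = (\<Prod>a\<leftarrow>diag_mat D. [:- a, 1:])"
    using carrier by (intro char_poly_upper_triangular[of _ n]) (auto simp: D_def upper_triangular_def)
  also have "diag_mat D = map d [0..<n]"
    by (simp add: diag_mat_def D_def)
  also have "(\<Prod>a\<leftarrow>map d [0..<n]. [:- a, 1:]) = (\<Prod>i<n. [:- d i, 1:])"
    by (simp add: prod.distinct_set_conv_list[symmetric] atLeast0LessThan comp_def)
  finally show ?thesis unfolding A_def .
qed

text \<open>For nonedges, \<open>(d i - d j) X\<^sub>i\<^sub>j\<close> is an entry of \<open>-[B - D, X]\<close>, hence smaller than the entries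
  of \<open>X\<close> when \<open>B\<close> is close to \<open>D = diag d\<close>.\<close>
lemma SSP_near_diagonal:
  fixes d :: "nat \<Rightarrow> real" and B :: "nat \<Rightarrow> nat \<Rightarrow> real"
  assumes nz: "\<And>i j. i < n \<Longrightarrow> j < n \<Longrightarrow> i \<noteq> j \<Longrightarrow> d i = d j \<Longrightarrow> B i j \<noteq> 0"
    and close: "\<And>i j. i < n \<Longrightarrow> j < n \<Longrightarrow> \<bar>B i j - (if i = j then d i else 0)\<bar> \<le> e"
    and g: "\<And>i j. i < n \<Longrightarrow> j < n \<Longrightarrow> \<bar>1 / (d j - d i)\<bar> \<le> g"
    and q: "2 * real n * e * g < 1" and e0: "e \<ge> 0" and g0: "g \<ge> 0"
  shows "SSP (mat n n (\<lambda>(i, j). B i j))"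
proof -
  define A where "A = mat n n (\<lambda>(i, j). B i j)"
  have dimA: "A \<in> carrier_mat n n" "dim_row A = n" by (simp_all add: A_def)
  show ?thesis
    unfolding SSP_def A_def[symmetric] dimA
  proof (intro ballI impI, elim conjE)
    fix X assume X: "X \<in> carrier_mat n n" and AX: "\<forall>i<n. \<forall>j<n. A $$ (i, j) * X $$ (i, j) = 0"
      and diag: "\<forall>i<n. X $$ (i, i) = 0" and comm: "A * X - X * A = 0\<^sub>m n n"
    define R where "R i j = B i j - (if i = j then d i else 0)" for i j
    define x where "x i j = X $$ (i, j)" for i j
    have R: "\<bar>R i j\<bar> \<le> e" if "i < n" "j < n" for i j using close[OF that] by (simp add: R_def)
    have eq: "(d j - d i) * x i j = (\<Sum>l<n. R i l * x l j) - (\<Sum>l<n. x i l * R l j)"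
      if ij: "i < n" "j < n" for i j
    proof -
      have "0 = (A * X - X * A) $$ (i, j)" using comm ij by simp
      also have "\<dots> = (\<Sum>l<n. B i l * x l j) - (\<Sum>l<n. x i l * B l j)"
        using ij X by (simp add: A_def x_def scalar_prod_def atLeast0LessThan)
      also have "(\<Sum>l<n. B i l * x l j) = (\<Sum>l<n. R i l * x l j + (if l = i then d i * x i j else 0))"
        by (intro sum.cong) (auto simp: R_def algebra_simps)
      also have "\<dots> = (\<Sum>l<n. R i l * x l j) + d i * x i j"
        using ij by (simp add: sum.distrib)
      also have "(\<Sum>l<n. x i l * B l j) = (\<Sum>l<n. x i l * R l j + (if l = j then x i j * d j else 0))"
        by (intro sum.cong) (auto simp: R_def algebra_simps)
      also have "\<dots> = (\<Sum>l<n. x i l * R l j) + x i j * d j"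
        using ij by (simp add: sum.distrib)
      finally show ?thesis by (simp add: algebra_simps)
    qed
    have "x i j = 0" if "i < n" "j < n" for i j
    proof (rule zero_if_self_bounded[OF q _ that])
      fix M assume M: "M \<ge> 0" "\<forall>i<n. \<forall>j<n. \<bar>x i j\<bar> \<le> M"
      show "\<forall>i<n. \<forall>j<n. \<bar>x i j\<bar> \<le> 2 * real n * e * g * M"
      proof (intro allI impI)
        fix i j assume ij: "i < n" "j < n"
        show "\<bar>x i j\<bar> \<le> 2 * real n * e * g * M"
        proof (cases "d i = d j")
          case True
          then have "x i j = 0"
            using AX diag nz[OF ij] ij by (cases "i = j") (auto simp: A_def x_def)
          then show ?thesis using e0 g0 M by simp
        next
          case False
          have "\<bar>\<Sum>l<n. R i l * x l j\<bar> \<le> real n * (e * M)" "\<bar>\<Sum>l<n. x i l * R l j\<bar> \<le> real n * (M * e)"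
            using M R ij by (auto intro!: abs_sum_lessThan_le abs_mult_le)
          then have "\<bar>(d j - d i) * x i j\<bar> \<le> 2 * real n * e * M"
            unfolding eq[OF ij] by (simp add: algebra_simps)
          then have "\<bar>((d j - d i) * x i j) * (1 / (d j - d i))\<bar> \<le> 2 * real n * e * M * g"
            using g[OF ij] by (rule abs_mult_le)
          moreover have "((d j - d i) * x i j) * (1 / (d j - d i)) = x i j"
            using False by (simp add: field_simps)
          ultimately have "\<bar>x i j\<bar> \<le> 2 * real n * e * M * g" by (simp only:)
          then show ?thesis by (simp only: ac_simps)
        qed
      qed
    qed
    then show "X = 0\<^sub>m n n" using X by (auto simp: x_def)
  qed
qed

text \<open>The weights \<open>W i j = x ^ i * x ^ j\<close> make the sums in \<open>S_ne\<close> nonzero polynomials in \<open>x\<close>;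
  these sums are the second order terms of the entries of the matrix inside the level sets of \<open>d\<close>.\<close>
lemma ex_matrix_of_labelling:
  fixes d :: "nat \<Rightarrow> real" and E :: "nat set set"
  assumes clique: "\<And>i j. i < n \<Longrightarrow> j < n \<Longrightarrow> i \<noteq> j \<Longrightarrow> d i = d j \<Longrightarrow> {i, j} \<in> E"
    and common: "\<And>i j. i < n \<Longrightarrow> j < n \<Longrightarrow> i \<noteq> j \<Longrightarrow> d i = d j \<Longrightarrow>
      \<exists>l<n. {i, l} \<in> E \<and> {l, j} \<in> E \<and> d l \<noteq> d i"
  shows "\<exists>A. in_S n E A \<and> SSP A \<and> spec_is A (image_mset d (mset_set {0..<n}))"
proof -
  let ?pairs = "{(i, j). i < n \<and> j < n \<and> i \<noteq> j \<and> d i = d j}"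
  let ?N = "\<lambda>i j. {l. l < n \<and> {i, l} \<in> E \<and> {l, j} \<in> E \<and> d l \<noteq> d i}"
  define p where "p i j = (\<Sum>l\<in>?N i j. monom (1 / (d j - d l)) (2 * l))" for i j
  have p_ne: "p i j \<noteq> 0" if ij: "(i, j) \<in> ?pairs" for i j
  proof -
    obtain k where k: "k \<in> ?N i j" using common[of i j] ij by auto
    \<comment> \<open>Distinct \<open>l\<close> give distinct degrees, so the term of the common
      neighbour \<open>k\<close> cannot cancel.\<close>
    have "coeff (p i j) (2 * k) = (\<Sum>l\<in>?N i j. if l = k then 1 / (d j - d k) else 0)"
      unfolding p_def coeff_sum by (intro sum.cong) auto
    also have "\<dots> = 1 / (d j - d k)" using k by simp
    finally show ?thesis using k ij by auto
  qed
  have "finite ?pairs" by (rule finite_subset[of _ "{..<n} \<times> {..<n}"]) auto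
  then have "finite (\<Union>a\<in>?pairs. {x. poly (p (fst a) (snd a)) x = 0})"
    using p_ne by (intro finite_UN_I poly_roots_finite) auto
  moreover have "infinite {0<..<1::real}" by (simp add: infinite_Ioo)
  ultimately have "\<not> {0<..<1} \<subseteq> (\<Union>a\<in>?pairs. {x. poly (p (fst a) (snd a)) x = 0})"
    using finite_subset by blast
  then obtain x :: real where x: "x > 0" "\<And>i j. (i, j) \<in> ?pairs \<Longrightarrow> poly (p i j) x \<noteq> 0"
    by fastforce
  define W where "W i j = (if {i, j} \<in> E \<and> d i \<noteq> d j then x ^ i * x ^ j else 0)" for i j
  have W0: "W i j = 0" if "d i = d j" for i j using that by (simp add: W_def)
  have W_sym: "W i j = W j i" for i j
    unfolding W_def insert_commute[of i j] by (cases "d i = d j") (auto simp: mult.commute)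
  define S where "S i j = (\<Sum>l<n. W i l * (W l j / (d j - d l)))" for i j
  have S_ne: "S i j \<noteq> 0" if ij: "(i, j) \<in> ?pairs" for i j
  proof -
    have "S i j = (\<Sum>l\<in>?N i j. W i l * (W l j / (d j - d l)))"
      unfolding S_def using ij by (intro sum.mono_neutral_right) (auto simp: W_def)
    also have "\<dots> = (\<Sum>l\<in>?N i j. x ^ i * x ^ j * (x ^ (2 * l) / (d j - d l)))"
      using ij by (intro sum.cong refl) (auto simp: W_def mult_2 power_add)
    also have "\<dots> = x ^ i * x ^ j * poly (p i j) x"
      by (simp add: p_def poly_sum poly_monom sum_distrib_left)
    finally show ?thesis using x ij by auto
  qed
  obtain w where w: "w \<ge> 0" "\<And>i j. i < n \<Longrightarrow> j < n \<Longrightarrow> \<bar>W i j\<bar> \<le> w"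
    using ex_entry_bound[of n W] by blast
  obtain g where g: "g \<ge> 0" "\<And>i j. i < n \<Longrightarrow> j < n \<Longrightarrow> \<bar>1 / (d j - d i)\<bar> \<le> g"
    using ex_entry_bound[of n "\<lambda>i j. 1 / (d j - d i)"] by blast
  \<comment> \<open>On the pairs with equal labels, where \<open>S i j\<close> is nonzero,
    \<open>s\<close> bounds it away from 0.\<close>
  obtain s where s: "s \<ge> 0" "\<And>i j. i < n \<Longrightarrow> j < n \<Longrightarrow> \<bar>1 / S i j\<bar> \<le> s"
    using ex_entry_bound[of n "\<lambda>i j. 1 / S i j"] by blast
  obtain K t0 where K: "K \<ge> 0" and t0: "t0 > 0" and
    ex_Z: "\<And>t. 0 < t \<and> t \<le> t0 \<Longrightarrow> \<exists>Z :: nat \<Rightarrow> nat \<Rightarrow> real.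
    (\<forall>i j. \<bar>Z i j\<bar> \<le> K * t) \<and> (\<forall>i j. d i = d j \<longrightarrow> Z i j = 0) \<and>
    (\<forall>i<n. \<forall>j<n. d i \<noteq> d j \<longrightarrow> \<bar>Z i j - t * W i j / (d j - d i)\<bar> \<le> K * t\<^sup>2) \<and>
    (\<forall>i<n. \<forall>j<n. d i \<noteq> d j \<longrightarrow> (d j - d i) * Z i j = t * (W i j + ((\<Sum>l<n. W i l * Z l j) -
       (\<Sum>l<n. (if d l = d i then \<Sum>k<n. W i k * Z k l else 0) * Z l j))))"
    using ex_block_eigenvectors[where n = n and W = W and d = d] by blast
  let ?n = "real n"
  \<comment> \<open>Chosen so that \<open>e * t\<close> bounds the distance of the entries of
    \<open>B\<close> from the diagonal matrix of \<open>d\<close>.\<close>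
  define e where "e = w + ?n * (w * K)"
  \<comment> \<open>\<open>c\<close> adds up three requirements, each of which follows from
    \<open>c * t < 1\<close>: invertibility of \<open>I + Z\<close> together with symmetry of
    \<open>B\<close>, the strong spectral property, and nonzero entries inside the level
    sets.\<close>
  define c where "c = ?n * K + 2 * ?n * e * g + ?n * w * K * s"
  have nonneg: "e \<ge> 0" "?n * K \<ge> 0" "2 * ?n * e * g \<ge> 0" "?n * w * K * s \<ge> 0" "c \<ge> 0"
    using w g s K by (simp_all add: e_def c_def)
  define t where "t = min (min t0 1) (1 / (c + 1))"
  have t: "0 < t" "t \<le> t0" "t \<le> 1" using t0 nonneg by (auto simp: t_def)
  have "c * t \<le> c * (1 / (c + 1))" using nonneg by (intro mult_left_mono) (auto simp: t_def)
  also have "\<dots> < 1" using nonneg by simp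
  finally have ct: "c * t < 1" .
  have small: "?n * (K * t) < 1" "2 * ?n * (e * t) * g < 1" "?n * w * K * s * t < 1"
  proof -
    have "c * t = ?n * (K * t) + 2 * ?n * (e * t) * g + ?n * w * K * s * t"
      by (simp add: c_def algebra_simps)
    moreover have "?n * (K * t) \<ge> 0" "2 * ?n * (e * t) * g \<ge> 0" "?n * w * K * s * t \<ge> 0"
      using nonneg t w g s K by simp_all
    ultimately show "?n * (K * t) < 1" "2 * ?n * (e * t) * g < 1" "?n * w * K * s * t < 1"
      using ct by linarith+
  qed
  obtain Z :: "nat \<Rightarrow> nat \<Rightarrow> real" where Ze: "\<And>i j. \<bar>Z i j\<bar> \<le> K * t"
    and Z0: "\<And>i j. d i = d j \<Longrightarrow> Z i j = 0"
    and Z1: "\<And>i j. i < n \<Longrightarrow> j < n \<Longrightarrow> d i \<noteq> d j \<Longrightarrow> \<bar>Z i j - t * W i j / (d j - d i)\<bar> \<le> K * t\<^sup>2"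
    and Zeq: "\<And>i j. i < n \<Longrightarrow> j < n \<Longrightarrow> d i \<noteq> d j \<Longrightarrow>
      (d j - d i) * Z i j = t * (W i j + ((\<Sum>l<n. W i l * Z l j) -
       (\<Sum>l<n. (if d l = d i then \<Sum>k<n. W i k * Z k l else 0) * Z l j)))"
    using ex_Z[of t] t by blast
  define B where "B i j = (if d i = d j then (if i = j then d i else 0) - t * (\<Sum>k<n. W i k * Z k j)
    else t * W i j)" for i j
  have sim: "(\<Sum>l<n. B i l * ((if l = j then 1 else 0) + Z l j)) = ((if i = j then 1 else 0) + Z i j) * d j"
    if "i < n" "j < n" for i j
    by (rule block_similarity[OF W0 Z0 Zeq B_def that])
  have B_sym: "B i j = B j i" if "i < n" "j < n" for i j
    by (rule block_symmetric[OF Z0 _ sim Ze small(1) that]) (auto simp: B_def W_sym)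
  have B_ne: "B i j \<noteq> 0" if "i < n" "j < n" "i \<noteq> j" "d i = d j" for i j
  proof -
    have ij: "(i, j) \<in> ?pairs" using that by simp
    \<comment> \<open>Replacing \<open>Z\<close> by its first order term turns the sum into
      \<open>t * S i j\<close> with an error of order \<open>t\<^sup>2\<close>, which the choice of
      \<open>t\<close> keeps below the main term.\<close>
    have "(\<Sum>k<n. W i k * Z k j) - t * S i j = (\<Sum>l<n. W i l * (Z l j - t * W l j / (d j - d l)))"
      by (simp add: S_def sum_distrib_left right_diff_distrib sum_subtractf algebra_simps)
    moreover have "\<bar>\<Sum>l<n. W i l * (Z l j - t * W l j / (d j - d l))\<bar> \<le> ?n * (w * (K * t\<^sup>2))"
    proof (intro abs_sum_lessThan_le abs_mult_le)
      fix l assume l: "l < n"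
      show "\<bar>W i l\<bar> \<le> w" using w l that by blast
      show "\<bar>Z l j - t * W l j / (d j - d l)\<bar> \<le> K * t\<^sup>2"
        using Z1[of l j] Z0[of l j] W0[of l j] l that K by (cases "d l = d j") auto
    qed
    moreover have "?n * (w * (K * t\<^sup>2)) < t * \<bar>S i j\<bar>"
    proof -
      have "1 \<le> s * \<bar>S i j\<bar>" using s(2)[of i j] that S_ne[OF ij] by (simp add: field_simps)
      then have "?n * w * K * t * 1 \<le> ?n * w * K * t * (s * \<bar>S i j\<bar>)"
        using w K t by (intro mult_left_mono) auto
      also have "\<dots> = (?n * w * K * s * t) * \<bar>S i j\<bar>" by simp
      also have "\<dots> < 1 * \<bar>S i j\<bar>"
        using small(3) S_ne[OF ij] by (intro mult_strict_right_mono) auto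
      finally have "t * (?n * w * K * t) < t * \<bar>S i j\<bar>" using t by simp
      then show ?thesis by (simp add: power2_eq_square algebra_simps)
    qed
    moreover have "t * \<bar>S i j\<bar> = \<bar>t * S i j\<bar>" using t by (simp add: abs_mult)
    ultimately have "(\<Sum>k<n. W i k * Z k j) \<noteq> 0" by auto
    then show ?thesis using that t by (simp add: B_def)
  qed
  have B_close: "\<bar>B i j - (if i = j then d i else 0)\<bar> \<le> e * t" if ij: "i < n" "j < n" for i j
  proof (cases "d i = d j")
    case True
    have "\<bar>\<Sum>k<n. W i k * Z k j\<bar> \<le> ?n * (w * (K * t))"
      using w ij Ze by (intro abs_sum_lessThan_le abs_mult_le) auto
    also have "\<dots> \<le> ?n * (w * (K * 1))"
      using w K t by (intro mult_left_mono) auto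
    also have "\<dots> \<le> e" using w by (simp add: e_def)
    finally have "\<bar>t * (\<Sum>k<n. W i k * Z k j)\<bar> \<le> t * e"
      using t by (intro abs_mult_le) auto
    then show ?thesis using True by (simp add: B_def mult.commute)
  next
    case False
    have "\<bar>W i j\<bar> \<le> e" using w(2)[OF ij] w(1) K by (simp add: e_def add_increasing2)
    then have "\<bar>t * W i j\<bar> \<le> t * e" using t by (intro abs_mult_le) auto
    then show ?thesis using False by (auto simp: B_def mult.commute)
  qed
  define A where "A = mat n n (\<lambda>(i, j). B i j)"
  have "in_S n E A"
    unfolding in_S_def
  proof (intro conjI allI impI)
    show "A \<in> carrier_mat n n" by (simp add: A_def)
    show "A\<^sup>T = A" using B_sym by (auto simp: A_def)
    fix i j assume ij: "i < n" "j < n" "i \<noteq> j"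
    show "A $$ (i, j) \<noteq> 0 \<longleftrightarrow> {i, j} \<in> E"
    proof (cases "d i = d j")
      case True
      then show ?thesis using B_ne clique ij by (simp add: A_def)
    next
      case False
      then show ?thesis using ij t x by (simp add: A_def B_def W_def)
    qed
  qed
  moreover have "SSP A"
    unfolding A_def using nonneg t g small B_ne B_close by (intro SSP_near_diagonal[of n d B "e * t" g]) auto
  moreover have "spec_is A (image_mset d (mset_set {0..<n}))"
  proof -
    have "char_poly A = (\<Prod>i<n. [:- d i, 1:])"
      unfolding A_def using sim Ze small(1) by (rule char_poly_of_diagonalization)
    then show ?thesis
      by (simp add: spec_is_def prod_unfold_prod_mset atLeast0LessThan image_mset.compositionality comp_def)
  qed
  ultimately show ?thesis by blast
qed

section \<open>Distribution of the eigenvalues over the blocks\<close>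

lemma ex_list_of_image_mset:
  assumes "image_mset f M = mset ys"
  shows "\<exists>xs. mset xs = M \<and> map f xs = ys"
  using assms
proof (induction ys arbitrary: M)
  case (Cons y ys)
  then obtain N x where N: "M = add_mset x N" "f x = y" "image_mset f N = mset ys"
    using msed_map_invR[of f M y "mset ys"] by auto
  then obtain xs where "mset xs = N" "map f xs = ys" using Cons.IH by blast
  then show ?case using N by (intro exI[of _ "x # xs"]) auto
qed simp

text \<open>Serves to turn groups of multiplicities into groups of the eigenvalues carrying them;
  the parts of the image are pulled back one by one.\<close>

lemma ex_list_sum_of_image_mset:
  assumes "image_mset f M = sum_list Ps"
  shows "\<exists>Qs. sum_list Qs = M \<and> map (image_mset f) Qs = Ps"
  using assms
proof (induction Ps arbitrary: M)
  case (Cons P Ps)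
  then obtain A B where AB: "M = A + B" "image_mset f A = P" "image_mset f B = sum_list Ps"
    using image_mset_eq_plusD[of f M P "sum_list Ps"] by auto
  then obtain Qs where "sum_list Qs = B" "map (image_mset f) Qs = Ps" using Cons.IH by blast
  then show ?case using AB by (intro exI[of _ "A # Qs"]) auto
qed simp

lemma ex_labelling_image_mset:
  assumes "finite V" "card V = size S"
  shows "\<exists>d. image_mset d (mset_set V) = S"
proof -
  obtain xs where xs: "mset xs = S" using ex_mset by blast
  obtain vs where vs: "set vs = V" "distinct vs" using finite_distinct_list[OF assms(1)] by blast
  have len: "length vs = length xs"
    using assms vs xs by (metis distinct_card size_mset)
  have "image_mset (\<lambda>v. the (map_of (zip vs xs) v)) (mset vs) = mset (map (\<lambda>v. the (map_of (zip vs xs) v)) vs)"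
    by simp
  also have "map (\<lambda>v. the (map_of (zip vs xs) v)) vs = xs"
    using len vs by (intro nth_equalityI) (auto simp: map_of_zip_nth)
  finally show ?thesis
    using vs xs by (metis mset_set_set)
qed

lemma mset_set_UN_lessThan:
  fixes h :: nat
  assumes "\<And>i. i < h \<Longrightarrow> finite (V i)" "\<And>i j. i < h \<Longrightarrow> j < h \<Longrightarrow> i \<noteq> j \<Longrightarrow> V i \<inter> V j = {}"
  shows "mset_set (\<Union>i<h. V i) = (\<Sum>i<h. mset_set (V i))"
  using assms
proof (induction h)
  case (Suc h)
  have "mset_set (\<Union>i<h. V i) = (\<Sum>i<h. mset_set (V i))"
    by (rule Suc.IH) (use Suc.prems in auto)
  moreover have "(\<Union>i<h. V i) \<inter> V h = {}"
  proof -
    have "V i \<inter> V h = {}" if "i < h" for i using Suc.prems(2)[of i h] that by simp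
    then show ?thesis by blast
  qed
  moreover have "mset_set ((\<Union>i<h. V i) \<union> V h) = mset_set (\<Union>i<h. V i) + mset_set (V h)"
    using calculation Suc.prems(1) by (intro mset_set_Union) auto
  ultimately show ?case
    by (simp add: lessThan_Suc Un_commute add.commute)
qed simp

text \<open>Disjointness lets separately chosen labellings be glued, since a vertex determines the
  set it lies in.\<close>

lemma ex_labelling_family:
  fixes V :: "nat \<Rightarrow> 'a set" and S :: "nat \<Rightarrow> 'b multiset"
  assumes fin: "\<And>i. i < h \<Longrightarrow> finite (V i)" and size: "\<And>i. i < h \<Longrightarrow> card (V i) = size (S i)"
    and dis: "\<And>i j. i < h \<Longrightarrow> j < h \<Longrightarrow> i \<noteq> j \<Longrightarrow> V i \<inter> V j = {}"
  shows "\<exists>d. (\<forall>i<h. image_mset d (mset_set (V i)) = S i) \<and>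
    image_mset d (mset_set (\<Union>i<h. V i)) = (\<Sum>i<h. S i)"
proof -
  have "\<forall>i. \<exists>d. i < h \<longrightarrow> image_mset d (mset_set (V i)) = S i"
    using ex_labelling_image_mset fin size by blast
  from choice[OF this]
  obtain D where D: "\<And>i. i < h \<Longrightarrow> image_mset (D i) (mset_set (V i)) = S i" by blast
  define d where "d v = D (THE i. i < h \<and> v \<in> V i) v" for v
  have "d v = D i v" if "i < h" "v \<in> V i" for i v
  proof -
    have "(THE i. i < h \<and> v \<in> V i) = i" using that dis by (intro the_equality) auto
    then show ?thesis by (simp add: d_def)
  qed
  then have dV: "image_mset d (mset_set (V i)) = S i" if "i < h" for i
    using that fin unfolding D[OF that, symmetric] by (intro image_mset_cong) auto
  have "image_mset d (\<Sum>i<k. mset_set (V i)) = (\<Sum>i<k. S i)" if "k \<le> h" for k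
    using that dV by (induction k) auto
  then have "image_mset d (mset_set (\<Union>i<h. V i)) = (\<Sum>i<h. S i)"
    using mset_set_UN_lessThan[OF fin dis] by simp
  then show ?thesis using dV by blast
qed

text \<open>\<open>A\<close> is meant as a group of distinct eigenvalues, to which the
  multiplicities in \<open>\<sigma>\<close> are restored.\<close>

definition eigenvalue_part :: "'a multiset \<Rightarrow> 'a multiset \<Rightarrow> 'a multiset" where
  "eigenvalue_part \<sigma> A = sum_mset (image_mset (\<lambda>x. replicate_mset (count \<sigma> x) x) A)"

lemma size_eigenvalue_part: "size (eigenvalue_part \<sigma> A) = sum_mset (image_mset (count \<sigma>) A)"
  unfolding eigenvalue_part_def by (induction A) auto

lemma eigenvalue_part_union: "eigenvalue_part \<sigma> (A + B) = eigenvalue_part \<sigma> A + eigenvalue_part \<sigma> B"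
  unfolding eigenvalue_part_def by simp

lemma eigenvalue_part_empty: "eigenvalue_part \<sigma> {#} = {#}"
  unfolding eigenvalue_part_def by simp

lemma set_eigenvalue_part: "set_mset (eigenvalue_part \<sigma> A) \<subseteq> set_mset A"
  unfolding eigenvalue_part_def by (induction A) auto

lemma eigenvalue_part_support: "eigenvalue_part \<sigma> (mset_set (set_mset \<sigma>)) = \<sigma>"
proof -
  have "eigenvalue_part \<sigma> (mset_set (set_mset \<sigma>)) = (\<Sum>x\<in>set_mset \<sigma>. replicate_mset (count \<sigma> x) x)"
    by (simp add: eigenvalue_part_def sum_unfold_sum_mset)
  also have "\<dots> = \<sigma>"
  proof (rule multiset_eqI)
    fix y
    have "count (\<Sum>x\<in>set_mset \<sigma>. replicate_mset (count \<sigma> x) x) y = (\<Sum>x\<in>set_mset \<sigma>. if x = y then count \<sigma> y else 0)"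
      unfolding count_sum by (intro sum.cong) auto
    then show "count (\<Sum>x\<in>set_mset \<sigma>. replicate_mset (count \<sigma> x) x) y = count \<sigma> y"
      by (simp add: count_eq_zero_iff)
  qed
  finally show ?thesis .
qed

text \<open>An element of both parts would be counted twice in the sum; cutting the list before
  position \<open>j\<close> separates the two contributions.\<close>

lemma count_sum_list_le_one_disjoint:
  fixes Qs :: "'a multiset list"
  assumes "\<And>x. count (sum_list Qs) x \<le> 1" "i < j" "j < length Qs"
  shows "set_mset (Qs ! i) \<inter> set_mset (Qs ! j) = {}"
proof -
  have split: "sum_list Qs = sum_list (take j Qs) + sum_list (drop j Qs)"
    by (metis append_take_drop_id sum_list_append)
  have mem: "Qs ! i \<in> set (take j Qs)" "Qs ! j \<in> set (drop j Qs)"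
    using assms by (auto simp: in_set_conv_nth intro: exI[of _ i] exI[of _ 0])
  have le_sum: "count Q x \<le> count (sum_list L) x" if "Q \<in> set L" for Q x and L :: "'a multiset list"
    using that by (induction L) auto
  have le: "count (Qs ! i) x + count (Qs ! j) x \<le> 1" for x
    using le_sum[OF mem(1), of x] le_sum[OF mem(2), of x] assms(1)[of x] split by simp
  have "\<not> (x \<in># Qs ! i \<and> x \<in># Qs ! j)" for x
    using le[of x] by (auto simp flip: count_greater_zero_iff)
  then show ?thesis by blast
qed

section \<open>Labelling of the block graph by the eigenvalues\<close>

theorem theorem4p6:
  fixes m :: "nat list" and n k :: nat and E :: "nat set set"
    and r :: "nat multiset" and \<sigma> :: "real multiset"
  assumes "m \<noteq> []" and "\<forall>x\<in>set m. x > 0"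
    and "in_BG n E (map (\<lambda>x. x + 1) m)"
    and "1 \<le> k" and "k \<le> hd m"
    and "refinement_of r ({#k, hd m + 1 - k#} + mset (tl m))"
    and "mult_list \<sigma> = r"
  shows "\<exists>A. in_S n E A \<and> SSP A \<and> spec_is A \<sigma>"
proof -
  obtain m1 ms where m: "m = m1 # ms" using assms(1) by (cases m) auto
  have bg: "block_graph n E" and sizes: "image_mset card (mset_set (blocks n E)) = mset (map (\<lambda>x. x + 1) m)"
    using assms(3) unfolding in_BG_def by auto
  obtain P where P: "image_mset sum_mset P = {#k, m1 + 1 - k#} + mset ms" "sum_mset P = r"
    using assms(6) m unfolding refinement_of_def by auto
  have "image_mset sum_mset P = mset (k # (m1 + 1 - k) # ms)" using P by simp
  then obtain Ps where Ps: "mset Ps = P" "map sum_mset Ps = k # (m1 + 1 - k) # ms"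
    using ex_list_of_image_mset[of sum_mset P "k # (m1 + 1 - k) # ms"] by metis
  \<comment> \<open>The multiplicity list is the image of the support of \<open>\<sigma>\<close>
    under \<open>count\<close>, so the groups of the refinement lift to groups \<open>Qs\<close> of
    distinct eigenvalues.\<close>
  have "image_mset (count \<sigma>) (mset_set (set_mset \<sigma>)) = sum_list Ps"
    using assms(7) P(2) unfolding mult_list_def Ps(1)[symmetric] by (simp add: sum_mset_sum_list)
  then obtain Qs where Qs: "sum_list Qs = mset_set (set_mset \<sigma>)" "map (image_mset (count \<sigma>)) Qs = Ps"
    using ex_list_sum_of_image_mset by blast
  have mapQs: "map (\<lambda>Q. size (eigenvalue_part \<sigma> Q)) Qs = k # (m1 + 1 - k) # ms"
    unfolding Ps(2)[symmetric] Qs(2)[symmetric] by (simp add: size_eigenvalue_part)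
  then obtain A1 A2 As where As: "Qs = A1 # A2 # As" and A1: "size (eigenvalue_part \<sigma> A1) = k"
    and A2: "size (eigenvalue_part \<sigma> A2) = m1 + 1 - k" and sizeAs: "map (\<lambda>Q. size (eigenvalue_part \<sigma> Q)) As = ms"
    by (auto simp: map_eq_Cons_conv)
  have count1: "count (sum_list Qs) x \<le> 1" for x
    unfolding Qs by (cases "x \<in># \<sigma>") auto
  \<comment> \<open>The two groups of total multiplicities \<open>k\<close> and
    \<open>m1 + 1 - k\<close> are merged, since together they fill the root block.\<close>
  define Rs where "Rs = (A1 + A2) # As"
  have count_Rs: "count (sum_list Rs) x \<le> 1" for x
    using count1[of x] by (simp add: As Rs_def)
  have dis12: "set_mset A1 \<inter> set_mset A2 = {}"
    using count_sum_list_le_one_disjoint[OF count1, of 0 1] As by simp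
  obtain Bs where Bs: "mset Bs = mset_set (blocks n E)" "map card Bs = map (\<lambda>x. x + 1) m"
    using ex_list_of_image_mset[OF sizes] by blast
  have Bs_set: "set Bs = blocks n E"
    using Bs(1) finite_blocks by (metis finite_set_mset_mset_set set_mset_mset)
  have Bs_distinct: "distinct Bs"
    unfolding distinct_count_atmost_1 Bs(1) Bs_set using finite_blocks by (simp add: count_mset_set')
  define h where "h = length Bs"
  have h: "h = length Rs" "h > 0" "length m = h"
    using arg_cong[OF Bs(2), of length] arg_cong[OF sizeAs, of length]
    by (simp_all add: h_def Rs_def m)
  have block: "Bs ! i \<in> blocks n E" if "i < h" for i
    using nth_mem[of i Bs] that unfolding Bs_set h_def .
  have B0: "Bs ! 0 \<in> blocks n E" using block h(2) .
  obtain p where p: "p (Bs ! 0) = Bs ! 0" "\<forall>B \<in> blocks n E - {Bs ! 0}. \<exists>v\<in>B. p B = B - {v}"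
    "disjoint_family_on p (blocks n E)" "(\<Union>B\<in>blocks n E. p B) = {0..<n}"
    by (rule block_graph_partition[OF bg B0])
  define V where "V i = p (Bs ! i)" for i
  define S where "S i = eigenvalue_part \<sigma> (Rs ! i)" for i
  have finB: "finite (Bs ! i)" and subB: "Bs ! i \<subseteq> {0..<n}" if "i < h" for i
    using block[OF that] finite_subset unfolding blocks_def is_block_def by auto
  have V0: "V 0 = Bs ! 0" using p by (simp add: V_def)
  have Vi: "\<exists>v\<in>Bs ! i. V i = Bs ! i - {v}" if "i < h" "i \<noteq> 0" for i
  proof -
    have "Bs ! i \<noteq> Bs ! 0"
      using that Bs_distinct h(2) unfolding h_def by (simp add: nth_eq_iff_index_eq)
    then show ?thesis using p(2) block[OF that(1)] unfolding V_def by auto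
  qed
  have V_sub: "V i \<subseteq> Bs ! i" if "i < h" for i
    using V0 Vi[OF that] by (cases "i = 0") auto
  have dis: "V i \<inter> V j = {}" if "i < h" "j < h" "i \<noteq> j" for i j
    using p(3) block that Bs_distinct unfolding disjoint_family_on_def V_def h_def
    by (simp add: nth_eq_iff_index_eq)
  have cover: "(\<Union>i<h. V i) = {0..<n}"
  proof -
    have "set Bs = (!) Bs ` {..<h}" unfolding h_def set_conv_nth by auto
    then show ?thesis unfolding p(4)[symmetric] Bs_set[symmetric] V_def by (simp add: image_image)
  qed
  have cardB: "card (Bs ! i) = m ! i + 1" if "i < h" for i
    using arg_cong[OF Bs(2), of "\<lambda>l. l ! i"] that h(3) unfolding h_def by simp
  \<comment> \<open>The root block keeps all its \<open>m1 + 1\<close> vertices; every other block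
    has lost one and keeps \<open>m ! i\<close>.\<close>
  have cardV: "card (V i) = size (S i)" if "i < h" for i
  proof (cases i)
    case 0
    then show ?thesis
      using cardB[OF that] V0 A1 A2 assms(4,5) m by (simp add: S_def Rs_def eigenvalue_part_union)
  next
    case (Suc j)
    then obtain v where v: "v \<in> Bs ! i" "V i = Bs ! i - {v}" using Vi[OF \<open>i < h\<close>] by blast
    then have "card (V i) = m ! i"
      using cardB[OF that] by (simp add: card_Diff_singleton)
    also have "\<dots> = size (S i)"
    proof -
      have "j < length As" using Suc that h(1) by (simp add: Rs_def)
      then show ?thesis unfolding S_def Rs_def m Suc sizeAs[symmetric] by simp
    qed
    finally show ?thesis .
  qed
  have finV: "finite (V i)" if "i < h" for i
    using V_sub[OF that] finB[OF that] by (rule finite_subset)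
  obtain d where d: "\<And>i. i < h \<Longrightarrow> image_mset d (mset_set (V i)) = S i"
    and d_all: "image_mset d (mset_set {0..<n}) = (\<Sum>i<h. S i)"
    using ex_labelling_family[of h V S, OF finV cardV dis] unfolding cover by blast
  have dV: "d ` V i = set_mset (S i)" if "i < h" for i
    using finV[OF that] by (simp flip: d[OF that])
  have S_dis: "set_mset (S i) \<inter> set_mset (S j) = {}" if "i < j" "j < h" for i j
  proof -
    have "set_mset (Rs ! i) \<inter> set_mset (Rs ! j) = {}"
      using count_sum_list_le_one_disjoint[OF count_Rs] that h(1) by simp
    then show ?thesis
      using set_eigenvalue_part[of \<sigma> "Rs ! i"] set_eigenvalue_part[of \<sigma> "Rs ! j"]
      unfolding S_def by blast
  qed
  \<comment> \<open>Different parts receive disjoint sets of eigenvalues, so a label determines its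
    part.\<close>
  have same_part: "i = j" if "x \<in> V i" "y \<in> V j" "d x = d y" "i < h" "j < h" for i j x y
  proof -
    have "d x \<in># S i" "d x \<in># S j"
      using that(3) imageI[OF that(1), of d] imageI[OF that(2), of d] dV that(4,5) by simp_all
    then show ?thesis using S_dis[of i j] S_dis[of j i] that(4,5) by (cases i j rule: linorder_cases) auto
  qed
  have sum_S: "(\<Sum>i<h. S i) = \<sigma>"
  proof -
    have "(\<Sum>i<length L. eigenvalue_part \<sigma> (L ! i)) = eigenvalue_part \<sigma> (sum_list L)" for L
      by (induction L)
        (simp_all add: sum.lessThan_Suc_shift eigenvalue_part_union eigenvalue_part_empty del: sum.lessThan_Suc)
    then have "(\<Sum>i<h. S i) = eigenvalue_part \<sigma> (sum_list Rs)" unfolding S_def h(1) .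
    also have "sum_list Rs = mset_set (set_mset \<sigma>)" using Qs(1) by (simp add: Rs_def As add.assoc)
    finally show ?thesis by (simp add: eigenvalue_part_support)
  qed
  have clique: "{u, v} \<in> E" if "u \<in> Bs ! i" "v \<in> Bs ! i" "u \<noteq> v" "i < h" for u v i
    using bg block that unfolding block_graph_def by blast
  have part_of: "\<exists>i<h. u \<in> V i" if "u < n" for u using cover that by auto
  \<comment> \<open>As \<open>1 \<le> k\<close> and \<open>k \<le> m1\<close>, both groups of the
    root block are nonempty. Being disjoint, they provide two different labels, and \<open>c\<close>
    equals at most one of them.\<close>
  have root_values: "\<exists>l\<in>V 0. d l \<noteq> c" for c
  proof -
    have S0: "S 0 = eigenvalue_part \<sigma> A1 + eigenvalue_part \<sigma> A2"
      by (simp add: S_def Rs_def eigenvalue_part_union)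
    have "eigenvalue_part \<sigma> A1 \<noteq> {#}" "eigenvalue_part \<sigma> A2 \<noteq> {#}"
      using A1 A2 assms(4,5) m by auto
    then obtain a b where ab: "a \<in># eigenvalue_part \<sigma> A1" "b \<in># eigenvalue_part \<sigma> A2"
      by (auto simp: multiset_eq_iff simp flip: count_greater_zero_iff)
    then have "a \<noteq> b"
      using dis12 set_eigenvalue_part[of \<sigma> A1] set_eigenvalue_part[of \<sigma> A2] by blast
    moreover have "a \<in> d ` V 0" "b \<in> d ` V 0" using ab dV[OF h(2)] unfolding S0 by auto
    ultimately obtain x y where "x \<in> V 0" "y \<in> V 0" "d x \<noteq> d y" by blast
    then show ?thesis by (metis (full_types))
  qed
  have "\<exists>A. in_S n E A \<and> SSP A \<and> spec_is A (image_mset d (mset_set {0..<n}))"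
  proof (rule ex_matrix_of_labelling)
    fix u v assume uv: "u < n" "v < n" "u \<noteq> v" "d u = d v"
    obtain i where i: "i < h" "u \<in> V i" using part_of[OF uv(1)] by blast
    obtain j where "j < h" "v \<in> V j" using part_of[OF uv(2)] by blast
    then have iv: "v \<in> V i" using same_part[of u i v j] i uv(4) by simp
    then have uvB: "u \<in> Bs ! i" "v \<in> Bs ! i" using V_sub[OF i(1)] i(2) by blast+
    show "{u, v} \<in> E" by (rule clique[OF uvB uv(3) i(1)])
    \<comment> \<open>The common neighbour is, in the root block, a vertex with another label, and
      in any other block the attaching vertex, which belongs to a different part.\<close>
    obtain l where l: "l \<in> Bs ! i" "d l \<noteq> d u"
    proof (cases "i = 0")
      case True
      then show ?thesis using that root_values[of "d u"] V0 by auto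
    next
      case False
      then obtain l where l: "l \<in> Bs ! i" "V i = Bs ! i - {l}" using Vi[OF i(1)] by blast
      then have "l < n" using subB[OF i(1)] by auto
      then obtain j where j: "j < h" "l \<in> V j" using part_of by blast
      then have "d l \<noteq> d u" using same_part[of l j u i] l(2) i by auto
      then show ?thesis using that l by blast
    qed
    have "l \<noteq> u" "l \<noteq> v" using l uv by auto
    then have "{u, l} \<in> E" "{l, v} \<in> E" using clique[of u i l] clique[of l i v] l(1) uvB i(1) by auto
    moreover have "l < n" using l(1) subB[OF i(1)] by auto
    ultimately show "\<exists>l<n. {u, l} \<in> E \<and> {l, v} \<in> E \<and> d l \<noteq> d u" using l by blast
  qed
  then show ?thesis unfolding d_all sum_S .
qed

end
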